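(* Let $K$ be a convex body in $\mathbb{R}^2$ that contains the origin. Suppose the Gaussian surface area measure of $K$ is proportional to the spherical Lebesgue measure; that is, there exists $C>0$ such that $h=h_K$ is a nonnegative solution on $S^1$ to $$\frac{1}{2\pi}\, e^{-\frac{h'^2+h^2}{2}}\,(h''+h)=C. \qquad ( * )$$ Then $K$ is a disk centered at the origin, or, equivalently, $h$ is a constant function. In particular, for $C>0$: (1) if $0<C<\frac{e^{-1/2}}{2\pi}$, then $( * )$ has precisely two nonnegative solutions; (2) if $C=\frac{e^{-1/2}}{2\pi}$, then $( * )$ has a unique nonnegative solution; (3) if $C>\frac{e^{-1/2}}{2\pi}$, then $( * )$ has no nonnegative solutions.
   Context: A convex body in $\mathbb{R}^2$ is a compact convex set with nonempty interior. Its support function is $h_K(y)=\max\{x\cdot y: x\in K\}$; restricted to the unit circle $S^1$ it is regarded as a $2\pi$-periodic function of the angle $\theta$, and $'$ denotes $d/d\theta$. The Gaussian surface area measure of $K$ is the Borel measure on $S^1$ given by $S_{\gamma_2,K}(\eta)=\frac{1}{2\pi}\int_{\nu_K^{-1}(\eta)} e^{-|x|^2/2}\,d\mathcal{H}^1(x)$, where $\nu_K^{-1}(\eta)$ is the set of boundary points of $K$ having an outer unit normal in $\eta$. The equation $( * )$ is equivalent to $dS_{\gamma_2,K}=C\,d\mathcal{H}^1$ on $S^1$. Nonnegative solutions of $( * )$ are automatically $C^\infty$, and they are exactly the support functions of convex bodies containing the origin with this property. *)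

theory Defs
  imports "HOL-Analysis.Analysis"
begin

definition convex_body :: "'a::euclidean_space set \<Rightarrow> bool" where
  "convex_body K \<longleftrightarrow> compact K \<and> convex K \<and> interior K \<noteq> {}"

text \<open>The supremum is a maximum whenever \<open>K\<close> is compact and nonempty.\<close>
definition support_function :: "'a::euclidean_space set \<Rightarrow> 'a \<Rightarrow> real" where
  "support_function K y = (SUP x\<in>K. x \<bullet> y)"

definition unit_vec :: "real \<Rightarrow> real ^ 2" where
  "unit_vec \<theta> = vector [cos \<theta>, sin \<theta>]"

definition outer_unit_normal :: "'a::euclidean_space set \<Rightarrow> 'a \<Rightarrow> 'a \<Rightarrow> bool" where
  "outer_unit_normal K x u \<longleftrightarrow> norm u = 1 \<and> (\<forall>y\<in>K. y \<bullet> u \<le> x \<bullet> u)"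

definition inv_gauss_map :: "'a::euclidean_space set \<Rightarrow> 'a set \<Rightarrow> 'a set" where
  "inv_gauss_map K \<eta> = {x \<in> frontier K. \<exists>u\<in>\<eta>. outer_unit_normal K x u}"

text \<open>One-dimensional Hausdorff measure. The normalising constant is 1 in dimension one, so it
  agrees with length. Boundedness of the covering sets is required explicitly because
  \<open>diameter\<close> has no meaningful value on unbounded sets.\<close>
definition hausdorff1_size :: "real \<Rightarrow> 'a::metric_space set \<Rightarrow> ennreal" where
  "hausdorff1_size \<delta> A =
     (INF U\<in>{U :: nat \<Rightarrow> 'a set. A \<subseteq> (\<Union>i. U i) \<and> (\<forall>i. bounded (U i) \<and> diameter (U i) \<le> \<delta>)}.
        (\<Sum>i. ennreal (diameter (U i))))"

definition hausdorff1_outer :: "'a::metric_space set \<Rightarrow> ennreal" where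
  "hausdorff1_outer A = (SUP \<delta>\<in>{0<..}. hausdorff1_size \<delta> A)"

text \<open>\<open>hausdorff1_outer\<close> is a metric outer measure, hence countably additive on the Borel sets, so
  \<open>measure_of\<close> does not fall back to its default (null) measure here.\<close>
definition hausdorff1 :: "'a::metric_space measure" where
  "hausdorff1 = measure_of UNIV (sets borel) hausdorff1_outer"

text \<open>The value of the Gaussian surface area measure on a Borel set \<open>\<eta>\<close> of the unit circle.\<close>
definition gaussian_surface_area :: "(real ^ 2) set \<Rightarrow> (real ^ 2) set \<Rightarrow> ennreal" where
  "gaussian_surface_area K \<eta> =
     ennreal (1 / (2 * pi)) *
       (\<integral>\<^sup>+ x \<in> inv_gauss_map K \<eta>. ennreal (exp (- (norm x)\<^sup>2 / 2)) \<partial>hausdorff1)"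

text \<open>Equality of measures \<open>dS = C dH\<close> on the Borel sets of the circle; spherical Lebesgue measure
  is one-dimensional Hausdorff measure on the circle.\<close>
definition gaussian_surface_area_eq :: "(real ^ 2) set \<Rightarrow> real \<Rightarrow> bool" where
  "gaussian_surface_area_eq K C \<longleftrightarrow>
     (\<forall>\<eta>. \<eta> \<in> sets borel \<and> \<eta> \<subseteq> sphere 0 1 \<longrightarrow>
        gaussian_surface_area K \<eta> = ennreal C * emeasure hausdorff1 \<eta>)"

text \<open>Functions on the circle are encoded as \<open>2\<pi>\<close>-periodic functions of the angle; solutions are
  classical, with continuity of the second derivative following from the equation.\<close>
definition nonneg_solution :: "real \<Rightarrow> (real \<Rightarrow> real) \<Rightarrow> bool" where
  "nonneg_solution C h \<longleftrightarrow>
     (\<forall>\<theta>. h (\<theta> + 2 * pi) = h \<theta>) \<and>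
     (\<forall>\<theta>. h \<theta> \<ge> 0) \<and>
     (\<forall>\<theta>. h differentiable (at \<theta>)) \<and>
     (\<forall>\<theta>. deriv h differentiable (at \<theta>)) \<and>
     (\<forall>\<theta>. 1 / (2 * pi) * exp (- ((deriv h \<theta>)\<^sup>2 + (h \<theta>)\<^sup>2) / 2)
            * (deriv (deriv h) \<theta> + h \<theta>) = C)"

end

theory Submission
  imports Defs
begin

text \<open>
  Write \<open>c = 2 \<pi> C\<close>, let \<open>h\<close> be a solution, \<open>\<rho> = h'' + h\<close> the radius of curvature and \<open>w = 1 / \<rho>\<close>
  the curvature. The equation says \<open>w = exp (- (h'^2 + h^2) / 2) / c\<close>, and differentiating gives
  \<open>w' = - h'\<close>. Hence \<open>w + h\<close> is a constant \<open>A\<close>, and \<open>w'' + w = A - 1 / w\<close>. Integrate this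
  equation, and its product with \<open>w\<close>, over a period. With \<open>W\<close> and \<open>V\<close> the integrals of \<open>w\<close> and
  \<open>1 / w\<close>, the first gives \<open>V = 2 \<pi> A - W\<close>. The second, with Wirtinger's inequality, gives
  \<open>A W - 2 \<pi> \<le> W^2 / (2 \<pi>)\<close>. Together they say \<open>W V \<le> (2 \<pi>)^2\<close>, the reverse of the
  Cauchy--Schwarz inequality. So equality holds, \<open>w\<close> is constant, and so is \<open>h\<close>
  (\<open>periodic_solution_constant\<close>). A constant \<open>r \<ge> 0\<close> is a solution exactly if
  \<open>r exp (- r^2 / 2) = c\<close>; this function of \<open>r\<close> increases up to its maximum \<open>exp (-1/2)\<close> at \<open>r = 1\<close>
  and then decreases to \<open>0\<close>, which gives the three cases for \<open>C\<close>.

  It remains to connect the measure with the differential equation. First, one-dimensional Hausdorff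
  measure is a metric outer measure, so it is a measure on the Borel sets
  (\<open>emeasure_hausdorff1\<close>). If the Gaussian surface area measure of \<open>K\<close> is \<open>C\<close> times arc length
  of the circle, then no single normal direction carries mass, so for every angle \<open>t\<close> exactly one
  boundary point \<open>X t\<close> has the normal \<open>unit_vec t\<close>, and \<open>X\<close> is continuous by compactness. The
  chords of a short arc \<open>X ` {a..b}\<close> make an angle of at most \<open>b - a\<close> with any of its tangents.
  Therefore the Hausdorff measure of the arc agrees with the length of its chord up to a
  factor \<open>cos (b - a)\<close> (\<open>measure_arc_bounds\<close>). Comparing the masses of arcs of \<open>K\<close> and of the circle
  and letting \<open>b - a\<close> tend to \<open>0\<close> shows that \<open>X\<close> has the derivative \<open>\<rho> t\<close> times the unit tangent, where
  \<open>\<rho> t = c exp (|X t|^2 / 2)\<close> (\<open>normal_param_has_vector_derivative\<close>). Since \<open>h\<close> and \<open>h'\<close> are the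
  components of \<open>X\<close> along the normal and the tangent, this is the differential equation.

  Conversely, a support function that solves the equation is constant, so \<open>K\<close> is a disk centered at the origin,
  and the measure of a disk is computed from the scaling of Hausdorff measure.
\<close>

section \<open>One-dimensional Hausdorff measure\<close>

lemma diameter_le_dist:
  fixes S :: "'a::metric_space set"
  assumes "0 \<le> d" and "\<And>x y. x \<in> S \<Longrightarrow> y \<in> S \<Longrightarrow> dist x y \<le> d"
  shows "diameter S \<le> d"
  using assms by (auto simp: diameter_def intro!: cSUP_least)

lemma hausdorff1_size_le:
  assumes "A \<subseteq> (\<Union>i. U i)" "\<And>i. bounded (U i)" "\<And>i. diameter (U i) \<le> \<delta>"
  shows "hausdorff1_size \<delta> A \<le> (\<Sum>i. ennreal (diameter (U i)))"
  unfolding hausdorff1_size_def by (rule INF_lower) (use assms in auto)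

lemma hausdorff1_size_antimono: "\<delta> \<le> \<epsilon> \<Longrightarrow> hausdorff1_size \<epsilon> A \<le> hausdorff1_size \<delta> A"
  unfolding hausdorff1_size_def by (rule INF_superset_mono) (auto intro: order_trans)

lemma hausdorff1_size_mono: "A \<subseteq> B \<Longrightarrow> hausdorff1_size \<delta> A \<le> hausdorff1_size \<delta> B"
  unfolding hausdorff1_size_def by (rule INF_superset_mono) auto

lemma hausdorff1_size_le_outer: "\<delta> > 0 \<Longrightarrow> hausdorff1_size \<delta> A \<le> hausdorff1_outer A"
  unfolding hausdorff1_outer_def by (rule SUP_upper) auto

lemma hausdorff1_outer_least:
  "(\<And>\<delta>. \<delta> > 0 \<Longrightarrow> hausdorff1_size \<delta> A \<le> c) \<Longrightarrow> hausdorff1_outer A \<le> c"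
  unfolding hausdorff1_outer_def by (rule SUP_least) auto

lemma hausdorff1_outer_mono: "A \<subseteq> B \<Longrightarrow> hausdorff1_outer A \<le> hausdorff1_outer B"
  unfolding hausdorff1_outer_def by (intro SUP_mono) (auto intro: hausdorff1_size_mono)

text \<open>Finite covers suffice for upper bounds, because the empty set has diameter \<open>0\<close> and can
  fill up the sequence.\<close>

lemma hausdorff1_outer_finite_cover:
  assumes "\<And>\<delta>. \<delta> > 0 \<Longrightarrow> \<exists>(n::nat) U. A \<subseteq> (\<Union>i<n. U i) \<and> (\<forall>i<n. bounded (U i) \<and> diameter (U i) \<le> \<delta>)
     \<and> (\<Sum>i<n. diameter (U i)) \<le> c"
  shows "hausdorff1_outer (A :: 'a::metric_space set) \<le> ennreal c"
proof (rule hausdorff1_outer_least)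
  fix \<delta> :: real assume "\<delta> > 0"
  from assms[OF this] obtain n :: nat and U :: "nat \<Rightarrow> 'a set" where
    U: "A \<subseteq> (\<Union>i<n. U i)" "\<And>i. i < n \<Longrightarrow> bounded (U i) \<and> diameter (U i) \<le> \<delta>"
       "(\<Sum>i<n. diameter (U i)) \<le> c" by blast
  define V where "V i = (if i < n then U i else {})" for i
  have "hausdorff1_size \<delta> A \<le> (\<Sum>i. ennreal (diameter (V i)))"
    by (rule hausdorff1_size_le) (use U \<open>\<delta> > 0\<close> in \<open>force simp: V_def\<close>)+
  also have "\<dots> = (\<Sum>i<n. ennreal (diameter (V i)))"
    by (rule suminf_finite) (auto simp: V_def)
  also have "\<dots> = (\<Sum>i<n. ennreal (diameter (U i)))"
    by (rule sum.cong) (auto simp: V_def)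
  also have "\<dots> = ennreal (\<Sum>i<n. diameter (U i))"
    by (rule sum_ennreal) (use U in \<open>auto intro: diameter_ge_0\<close>)
  also have "\<dots> \<le> ennreal c" using U by (simp add: ennreal_leI)
  finally show "hausdorff1_size \<delta> A \<le> ennreal c" .
qed

lemma hausdorff1_outer_singleton [simp]: "hausdorff1_outer {x} = 0"
proof -
  have "hausdorff1_outer {x} \<le> ennreal 0"
    by (rule hausdorff1_outer_finite_cover) (rule exI[of _ 1], rule exI[of _ "\<lambda>_. {x}"], auto)
  thus ?thesis by simp
qed

lemma hausdorff1_outer_empty [simp]: "hausdorff1_outer {} = 0"
  using hausdorff1_outer_mono[of "{}" "{undefined}"] by simp

text \<open>Covers of the sets \<open>A n\<close> that are optimal up to \<open>e / 2^(n+1)\<close> are merged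
  into one sequence by the pairing function on the natural numbers.\<close>

lemma hausdorff1_size_countable_Union_le:
  fixes A :: "nat \<Rightarrow> 'a::metric_space set"
  assumes "\<delta> > 0"
  shows "hausdorff1_size \<delta> (\<Union>n. A n) \<le> (\<Sum>n. hausdorff1_size \<delta> (A n))"
proof (cases "\<forall>n. hausdorff1_size \<delta> (A n) \<noteq> \<infinity>")
  case False
  then obtain n where n: "hausdorff1_size \<delta> (A n) = \<infinity>" by auto
  have "(\<Sum>i\<in>{n}. hausdorff1_size \<delta> (A i)) \<le> (\<Sum>n. hausdorff1_size \<delta> (A n))"
    by (rule sum_le_suminf) auto
  thus ?thesis using n by (simp add: top_unique)
next
  case True
  show ?thesis
  proof (rule ennreal_le_epsilon)
    fix e :: real assume e: "e > 0"
    have "\<exists>U. A n \<subseteq> (\<Union>i. U i) \<and> (\<forall>i. bounded (U i) \<and> diameter (U i) \<le> \<delta>) \<and>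
       (\<Sum>i. ennreal (diameter (U i))) < hausdorff1_size \<delta> (A n) + ennreal (e * (1/2)^Suc n)" for n
    proof -
      have "e * (1/2)^Suc n > 0" using e by simp
      from INF_approx_ennreal[OF this hausdorff1_size_def[of \<delta> "A n"]] True
      show ?thesis by blast
    qed
    then obtain U where U: "\<And>n. A n \<subseteq> (\<Union>i. U n i)" "\<And>n i. bounded (U n i)" "\<And>n i. diameter (U n i) \<le> \<delta>"
       "\<And>n. (\<Sum>i. ennreal (diameter (U n i))) < hausdorff1_size \<delta> (A n) + ennreal (e * (1/2)^Suc n)"
      by metis
    define f where "f p = ennreal (diameter (U (fst p) (snd p)))" for p
    define V where "V k = U (fst (prod_decode k)) (snd (prod_decode k))" for k
    have "(\<Union>n. A n) \<subseteq> (\<Union>k. V k)"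
    proof
      fix x assume "x \<in> (\<Union>n. A n)"
      then obtain n where "x \<in> A n" by auto
      with U(1) obtain i where "x \<in> U n i" by blast
      hence "x \<in> V (prod_encode (n, i))" by (simp add: V_def)
      thus "x \<in> (\<Union>k. V k)" by blast
    qed
    hence "hausdorff1_size \<delta> (\<Union>n. A n) \<le> (\<Sum>k. ennreal (diameter (V k)))"
      by (rule hausdorff1_size_le) (auto simp: V_def U)
    also have "\<dots> = (\<Sum>k. f (prod_decode k))" by (simp add: V_def f_def)
    also have "\<dots> = (\<Sum>n. \<Sum>i. f (n, i))" by (rule suminf_ennreal_2dimen) auto
    also have "\<dots> \<le> (\<Sum>n. hausdorff1_size \<delta> (A n) + ennreal (e * (1/2)^Suc n))"
      using U(4) by (intro suminf_le) (auto simp: f_def intro: less_imp_le)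
    also have "\<dots> = (\<Sum>n. hausdorff1_size \<delta> (A n)) + (\<Sum>n. ennreal (e * (1/2)^Suc n))"
      by (rule suminf_add[symmetric]) auto
    also have "(\<Sum>n. ennreal (e * (1/2)^Suc n)) = ennreal e"
      using e by (intro suminf_ennreal_eq) (use sums_mult[OF power_half_series, of e] in auto)
    finally show "hausdorff1_size \<delta> (\<Union>n. A n) \<le> (\<Sum>n. hausdorff1_size \<delta> (A n)) + ennreal e" .
  qed
qed

lemma hausdorff1_outer_countable_Union_le:
  fixes A :: "nat \<Rightarrow> 'a::metric_space set"
  shows "hausdorff1_outer (\<Union>n. A n) \<le> (\<Sum>n. hausdorff1_outer (A n))"
proof (rule hausdorff1_outer_least)
  fix \<delta> :: real assume "\<delta> > 0"
  have "hausdorff1_size \<delta> (\<Union>n. A n) \<le> (\<Sum>n. hausdorff1_size \<delta> (A n))"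
    by (rule hausdorff1_size_countable_Union_le) fact
  also have "\<dots> \<le> (\<Sum>n. hausdorff1_outer (A n))"
    by (rule suminf_le) (auto intro: hausdorff1_size_le_outer \<open>\<delta> > 0\<close>)
  finally show "hausdorff1_size \<delta> (\<Union>n. A n) \<le> (\<Sum>n. hausdorff1_outer (A n))" .
qed

lemma hausdorff1_outer_Un_le:
  fixes A B :: "'a::metric_space set"
  shows "hausdorff1_outer (A \<union> B) \<le> hausdorff1_outer A + hausdorff1_outer B"
proof -
  define f where "f k = (if k = 0 then A else if k = 1 then B else {})" for k :: nat
  have "A \<union> B \<subseteq> (\<Union>k. f k)"
    unfolding f_def by (intro Un_least) (force intro: exI[of _ 0] exI[of _ 1])+
  hence "hausdorff1_outer (A \<union> B) \<le> hausdorff1_outer (\<Union>k. f k)" by (rule hausdorff1_outer_mono)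
  also have "\<dots> \<le> (\<Sum>k. hausdorff1_outer (f k))" by (rule hausdorff1_outer_countable_Union_le)
  also have "\<dots> = (\<Sum>k<2. hausdorff1_outer (f k))" by (rule suminf_finite) (auto simp: f_def)
  also have "\<dots> = hausdorff1_outer A + hausdorff1_outer B" by (simp add: f_def numeral_2_eq_2)
  finally show ?thesis .
qed

text \<open>Once the covering sets are smaller than the distance between \<open>A\<close> and \<open>B\<close>,
  none of them meets both, so a cover of the union splits into two disjoint covers.\<close>

lemma hausdorff1_outer_separated:
  fixes A B :: "'a::metric_space set"
  assumes e: "e > 0" and sep: "\<And>x y. x \<in> A \<Longrightarrow> y \<in> B \<Longrightarrow> e \<le> dist x y"
  shows "hausdorff1_outer A + hausdorff1_outer B \<le> hausdorff1_outer (A \<union> B)"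
proof -
  have small: "hausdorff1_size \<delta> A + hausdorff1_size \<delta> B \<le> hausdorff1_size \<delta> (A \<union> B)"
    if d: "0 < \<delta>" "\<delta> < e" for \<delta>
    unfolding hausdorff1_size_def[of \<delta> "A \<union> B"]
  proof (rule INF_greatest, clarify)
    fix U :: "nat \<Rightarrow> 'a set" assume U: "A \<union> B \<subseteq> (\<Union>i. U i)" "\<forall>i. bounded (U i) \<and> diameter (U i) \<le> \<delta>"
    define V where "V i = (if U i \<inter> A \<noteq> {} then U i else {})" for i
    define W where "W i = (if U i \<inter> B \<noteq> {} then U i else {})" for i
    have VW: "V i = {} \<or> W i = {}" for i
    proof (rule ccontr)
      assume "\<not> ?thesis"
      then obtain x y where "x \<in> U i" "x \<in> A" "y \<in> U i" "y \<in> B"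
        by (auto simp: V_def W_def split: if_splits)
      note xy = this
      have "dist x y \<le> diameter (U i)" using U(2) xy by (intro diameter_bounded_bound) auto
      also have "\<dots> \<le> \<delta>" using U(2) by auto
      finally show False using sep[of x y] xy d by linarith
    qed
    have "hausdorff1_size \<delta> A + hausdorff1_size \<delta> B
        \<le> (\<Sum>i. ennreal (diameter (V i))) + (\<Sum>i. ennreal (diameter (W i)))"
    proof (intro add_mono hausdorff1_size_le)
      show "A \<subseteq> (\<Union>i. V i)" using U(1) by (fastforce simp: V_def)
      show "B \<subseteq> (\<Union>i. W i)" using U(1) by (fastforce simp: W_def)
    qed (use U d in \<open>auto simp: V_def W_def\<close>)
    also have "\<dots> = (\<Sum>i. ennreal (diameter (V i)) + ennreal (diameter (W i)))"
      by (rule suminf_add) auto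
    also have "\<dots> \<le> (\<Sum>i. ennreal (diameter (U i)))"
    proof (rule suminf_le)
      fix i show "ennreal (diameter (V i)) + ennreal (diameter (W i)) \<le> ennreal (diameter (U i))"
        using VW[of i]
        by (cases "U i \<inter> A = {}"; cases "U i \<inter> B = {}"; cases "U i = {}") (simp_all add: V_def W_def)
    qed auto
    finally show "hausdorff1_size \<delta> A + hausdorff1_size \<delta> B \<le> (\<Sum>i. ennreal (diameter (U i)))" .
  qed
  have main: "hausdorff1_size a A + hausdorff1_size b B \<le> hausdorff1_outer (A \<union> B)"
    if ab: "a > 0" "b > 0" for a b
  proof -
    define \<delta> where "\<delta> = min (e/2) (min a b)"
    have d: "0 < \<delta>" "\<delta> < e" "\<delta> \<le> a" "\<delta> \<le> b" using e ab by (auto simp: \<delta>_def)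
    have "hausdorff1_size a A + hausdorff1_size b B \<le> hausdorff1_size \<delta> A + hausdorff1_size \<delta> B"
      by (intro add_mono hausdorff1_size_antimono d)
    also have "\<dots> \<le> hausdorff1_size \<delta> (A \<union> B)" by (rule small) fact+
    also have "\<dots> \<le> hausdorff1_outer (A \<union> B)" by (rule hausdorff1_size_le_outer) fact
    finally show ?thesis .
  qed
  show ?thesis
  proof -
    have ne: "{0::real<..} \<noteq> {}" by (auto intro: exI[of _ 1])
    have "hausdorff1_outer A + hausdorff1_outer B = (SUP a\<in>{0<..}. hausdorff1_size a A + hausdorff1_outer B)"
      unfolding hausdorff1_outer_def[of A] using ennreal_SUP_add_left[OF ne] by metis
    also have "\<dots> \<le> hausdorff1_outer (A \<union> B)"
    proof (rule SUP_least)
      fix a :: real assume a: "a \<in> {0<..}"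
      have "hausdorff1_size a A + hausdorff1_outer B = (SUP b\<in>{0<..}. hausdorff1_size a A + hausdorff1_size b B)"
        unfolding hausdorff1_outer_def[of B] using ennreal_SUP_add_right[OF ne] by metis
      also have "\<dots> \<le> hausdorff1_outer (A \<union> B)"
        by (rule SUP_least) (use a main in auto)
      finally show "hausdorff1_size a A + hausdorff1_outer B \<le> hausdorff1_outer (A \<union> B)" .
    qed
    finally show ?thesis .
  qed
qed

text \<open>Every closed set \<open>C\<close> splits every set \<open>A\<close> additively. The part of
  \<open>A\<close> at distance at least \<open>1/(n+1)\<close> from \<open>C\<close> is separated from \<open>A
  \<inter> C\<close>. The rest of \<open>A - C\<close> consists of thin shells around \<open>C\<close>; shells
  of the same parity are separated from each other, so the sum of their measures is at most twice the measure of
  \<open>A\<close>, and its tail is negligible.\<close>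

lemma hausdorff1_outer_closed_split:
  fixes A C :: "'a::metric_space set"
  assumes "closed C"
  shows "hausdorff1_outer (A \<inter> C) + hausdorff1_outer (A - C) \<le> hausdorff1_outer A"
proof (cases "hausdorff1_outer A = \<infinity> \<or> C = {}")
  case True
  thus ?thesis by auto
next
  case False
  hence fin: "hausdorff1_outer A < \<infinity>" and ne: "C \<noteq> {}" by (auto simp: less_top)
  define d where "d x = infdist x C" for x
  have d_lip: "\<bar>d x - d y\<bar> \<le> dist x y" for x y
    unfolding d_def by (rule infdist_triangle_abs)
  have d_pos: "d x > 0" if "x \<notin> C" for x
    using that assms ne infdist_pos_not_in_closed by (auto simp: d_def)
  define P where "P n = {x \<in> A. d x \<ge> 1 / real (n + 1)}" for n
  define R where "R k = {x \<in> A. 1 / real (k + 2) \<le> d x \<and> d x < 1 / real (k + 1)}" for k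
  have sep: "hausdorff1_outer (A \<inter> C) + hausdorff1_outer (P n) \<le> hausdorff1_outer A" for n
  proof -
    have "hausdorff1_outer (A \<inter> C) + hausdorff1_outer (P n) \<le> hausdorff1_outer (A \<inter> C \<union> P n)"
    proof (rule hausdorff1_outer_separated)
      fix x y assume "x \<in> A \<inter> C" "y \<in> P n"
      hence "d x = 0" "d y \<ge> 1 / real (n + 1)" by (auto simp: d_def P_def)
      thus "1 / real (n + 1) \<le> dist x y" using d_lip[of x y] by auto
    qed auto
    also have "\<dots> \<le> hausdorff1_outer A" by (rule hausdorff1_outer_mono) (auto simp: P_def)
    finally show ?thesis .
  qed
  have parity: "(\<Sum>k<m. hausdorff1_outer (R (2*k+b))) \<le> hausdorff1_outer (\<Union>k<m. R (2*k+b))" for m b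
  proof (induction m)
    case (Suc m)
    have "(\<Sum>k<Suc m. hausdorff1_outer (R (2*k+b)))
        \<le> hausdorff1_outer (\<Union>k<m. R (2*k+b)) + hausdorff1_outer (R (2*m+b))"
      using Suc by (simp add: add_right_mono)
    also have "\<dots> \<le> hausdorff1_outer ((\<Union>k<m. R (2*k+b)) \<union> R (2*m+b))"
    proof (cases "m = 0")
      case False
      show ?thesis
      proof (rule hausdorff1_outer_separated)
        show "1 / real (2*m+b) - 1 / real (2*m+b+1) > 0"
          using False by (simp add: divide_strict_left_mono)
        fix x y assume "x \<in> (\<Union>k<m. R (2*k+b))" "y \<in> R (2*m+b)"
        then obtain k where k: "k < m" "d x \<ge> 1 / real (2*k+b+2)" "d y < 1 / real (2*m+b+1)"
          by (auto simp: R_def)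
        have "1 / real (2*m+b) \<le> 1 / real (2*k+b+2)"
          using k(1) by (intro divide_left_mono) auto
        thus "1 / real (2*m+b) - 1 / real (2*m+b+1) \<le> dist x y" using k d_lip[of x y] by linarith
      qed
    qed auto
    also have "(\<Union>k<m. R (2*k+b)) \<union> R (2*m+b) = (\<Union>k<Suc m. R (2*k+b))"
      by (auto simp: lessThan_Suc)
    finally show ?case .
  qed auto
  have parity': "(\<Sum>k<m. hausdorff1_outer (R (2*k+b))) \<le> hausdorff1_outer A" for m b
    by (rule order_trans[OF parity], rule hausdorff1_outer_mono) (auto simp: R_def)
  have "(\<Sum>k<m. hausdorff1_outer (R k)) \<le> 2 * hausdorff1_outer A" for m
  proof -
    have "(\<Sum>k<m. hausdorff1_outer (R k)) \<le> (\<Sum>k<2*m. hausdorff1_outer (R k))"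
      by (rule sum_mono2) auto
    also have "\<dots> = (\<Sum>k<m. hausdorff1_outer (R (2*k+0))) + (\<Sum>k<m. hausdorff1_outer (R (2*k+1)))"
      by (induction m) (auto simp: algebra_simps)
    also have "\<dots> \<le> hausdorff1_outer A + hausdorff1_outer A" by (intro add_mono parity')
    finally show ?thesis by (simp add: mult_2)
  qed
  hence "(\<Sum>k. hausdorff1_outer (R k)) \<le> 2 * hausdorff1_outer A"
    by (intro suminf_le_const) auto
  also have "\<dots> < \<infinity>" using fin by (simp add: ennreal_mult_less_top)
  finally have finsum: "(\<Sum>k. hausdorff1_outer (R k)) \<noteq> \<infinity>" by simp
  define f where "f k = enn2real (hausdorff1_outer (R k))" for k
  have Rf: "hausdorff1_outer (R k) = ennreal (f k)" for k
  proof -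
    have "hausdorff1_outer (R k) \<le> hausdorff1_outer A"
      by (rule hausdorff1_outer_mono) (auto simp: R_def)
    also note fin
    finally show ?thesis by (simp add: f_def)
  qed
  have f0: "f k \<ge> 0" for k by (simp add: f_def)
  have sumf: "summable f"
    by (rule summable_suminf_not_top) (use f0 finsum Rf in auto)
  show ?thesis
  proof (rule ennreal_le_epsilon)
    fix e :: real assume e: "e > 0"
    obtain n where n: "norm (\<Sum>i. f (i + n)) < e" using suminf_exist_split[OF e sumf] by auto
    have "A - C \<subseteq> P n \<union> (\<Union>k. R (k + n))"
    proof
      fix x assume x: "x \<in> A - C"
      show "x \<in> P n \<union> (\<Union>k. R (k + n))"
      proof (cases "d x \<ge> 1 / real (n + 1)")
        case True thus ?thesis using x by (auto simp: P_def)
      next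
        case False
        define Q where "Q j \<longleftrightarrow> d x \<ge> 1 / real (j + 1)" for j
        have "\<exists>j. Q j"
        proof -
          obtain j where "inverse (real (Suc j)) < d x" using reals_Archimedean[of "d x"] d_pos x by auto
          thus ?thesis by (intro exI[of _ j]) (simp add: Q_def inverse_eq_divide)
        qed
        define j where "j = (LEAST j. Q j)"
        have j: "Q j" unfolding j_def using \<open>\<exists>j. Q j\<close> by (rule LeastI_ex)
        have "j > n"
        proof (rule ccontr)
          assume "\<not> j > n"
          hence "1 / real (n + 1) \<le> 1 / real (j + 1)" by (intro divide_left_mono) auto
          with j False show False by (simp add: Q_def)
        qed
        hence "j = (j - n - 1) + n + 1" by simp
        then obtain k where k: "j = k + n + 1" ..
        have "\<not> Q (k + n)" using not_less_Least[of "k+n" Q] k j_def by auto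
        hence "x \<in> R (k + n)" using j x k by (auto simp: Q_def R_def add_ac)
        thus ?thesis by blast
      qed
    qed
    hence "hausdorff1_outer (A - C) \<le> hausdorff1_outer (P n \<union> (\<Union>k. R (k + n)))"
      by (rule hausdorff1_outer_mono)
    also have "\<dots> \<le> hausdorff1_outer (P n) + (\<Sum>k. hausdorff1_outer (R (k + n)))"
      by (rule order_trans[OF hausdorff1_outer_Un_le add_left_mono]) (rule hausdorff1_outer_countable_Union_le)
    also have "(\<Sum>k. hausdorff1_outer (R (k + n))) = ennreal (\<Sum>k. f (k + n))"
      unfolding Rf using f0 sumf by (intro suminf_ennreal2) auto
    also have "\<dots> \<le> ennreal e" using n by (auto intro!: ennreal_leI)
    finally have "hausdorff1_outer (A - C) \<le> hausdorff1_outer (P n) + ennreal e" by (simp add: add_left_mono)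
    hence "hausdorff1_outer (A \<inter> C) + hausdorff1_outer (A - C)
        \<le> (hausdorff1_outer (A \<inter> C) + hausdorff1_outer (P n)) + ennreal e"
      by (metis add.assoc add_left_mono)
    also have "\<dots> \<le> hausdorff1_outer A + ennreal e" by (intro add_right_mono sep)
    finally show "hausdorff1_outer (A \<inter> C) + hausdorff1_outer (A - C) \<le> hausdorff1_outer A + ennreal e" .
  qed
qed

lemma outer_measure_space_hausdorff1_outer:
  "outer_measure_space UNIV (hausdorff1_outer :: 'a::metric_space set \<Rightarrow> ennreal)"
  by (auto simp: outer_measure_space_def positive_def increasing_def countably_subadditive_def
      intro: hausdorff1_outer_mono hausdorff1_outer_countable_Union_le)

lemma borel_subset_lambda_system_hausdorff1_outer:
  "sets borel \<subseteq> lambda_system UNIV UNIV (hausdorff1_outer :: 'a::metric_space set \<Rightarrow> ennreal)"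
proof -
  let ?L = "lambda_system UNIV UNIV (hausdorff1_outer :: 'a set \<Rightarrow> ennreal)"
  interpret P: sigma_algebra "UNIV :: 'a set" UNIV
    using sigma_algebra_Pow[of "UNIV :: 'a set"] by simp
  have "measure_space UNIV ?L hausdorff1_outer"
    by (rule P.caratheodory_lemma) (rule outer_measure_space_hausdorff1_outer)
  then interpret L: sigma_algebra UNIV ?L by (simp add: measure_space_def)
  have "C \<in> ?L" if "closed C" for C :: "'a set"
  proof -
    have "hausdorff1_outer (A \<inter> C) + hausdorff1_outer (A - C) = hausdorff1_outer A" for A
    proof (rule antisym)
      have "hausdorff1_outer A \<le> hausdorff1_outer ((A \<inter> C) \<union> (A - C))"
        by (rule hausdorff1_outer_mono) auto
      also have "\<dots> \<le> hausdorff1_outer (A \<inter> C) + hausdorff1_outer (A - C)"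
        by (rule hausdorff1_outer_Un_le)
      finally show "hausdorff1_outer A \<le> hausdorff1_outer (A \<inter> C) + hausdorff1_outer (A - C)" .
    qed (rule hausdorff1_outer_closed_split[OF that])
    thus ?thesis by (simp add: lambda_system_def Int_commute Diff_eq)
  qed
  hence "sigma_sets UNIV (Collect closed) \<subseteq> ?L"
    by (intro L.sigma_sets_subset) auto
  thus ?thesis by (simp add: borel_eq_closed sets_measure_of)
qed

lemma sets_hausdorff1 [simp, measurable_cong]: "sets hausdorff1 = sets borel"
  unfolding hausdorff1_def using sets.sigma_sets_eq[of borel] by (simp add: sets_measure_of)

text \<open>This is where the value of \<open>measure_of\<close> is identified: by Caratheodory's theorem the
  outer measure is countably additive on its measurable sets, and these include all Borel sets.\<close>

lemma emeasure_hausdorff1: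
  fixes A :: "'a::metric_space set"
  assumes "A \<in> sets borel"
  shows "emeasure hausdorff1 A = hausdorff1_outer A"
proof -
  interpret P: sigma_algebra "UNIV :: 'a set" UNIV
    using sigma_algebra_Pow[of "UNIV :: 'a set"] by simp
  have "measure_space UNIV (lambda_system UNIV UNIV hausdorff1_outer) (hausdorff1_outer :: 'a set \<Rightarrow> ennreal)"
    by (rule P.caratheodory_lemma) (rule outer_measure_space_hausdorff1_outer)
  moreover have sb: "sigma_algebra UNIV (sets (borel :: 'a measure))"
    using sets.sigma_algebra_axioms[of "borel :: 'a measure"] by simp
  ultimately have "measure_space UNIV (sets borel) (hausdorff1_outer :: 'a set \<Rightarrow> ennreal)"
    using measure_down borel_subset_lambda_system_hausdorff1_outer by blast
  thus ?thesis unfolding hausdorff1_def using assms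
    by (intro emeasure_measure_of_sigma) (auto simp: measure_space_def)
qed

text \<open>The distance function from \<open>p\<close> is a contraction which maps a connected set through
  \<open>p\<close> and \<open>q\<close> onto an interval of length at least \<open>dist p q\<close>, so Lebesgue
  measure on the line gives the lower bound.\<close>

lemma dist_le_hausdorff1_outer_connected:
  fixes S :: "'a::metric_space set"
  assumes S: "connected S" "p \<in> S" "q \<in> S"
  shows "ennreal (dist p q) \<le> hausdorff1_outer S"
proof -
  have "ennreal (dist p q) \<le> hausdorff1_size 1 S"
    unfolding hausdorff1_size_def
  proof (rule INF_greatest, clarify)
    fix U :: "nat \<Rightarrow> 'a set" assume U: "S \<subseteq> (\<Union>i. U i)" "\<forall>i. bounded (U i) \<and> diameter (U i) \<le> 1"
    define a where "a i = Inf (dist p ` U i)" for i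
    define I where "I i = (if U i = {} then {} else {a i .. a i + diameter (U i)})" for i
    have sub: "{0..dist p q} \<subseteq> (\<Union>i. I i)"
    proof
      fix t assume t: "t \<in> {0..dist p q}"
      have "connected (dist p ` S)"
        using S(1) by (intro connected_continuous_image continuous_intros)
      hence "t \<in> dist p ` S"
        using connectedD_interval[of "dist p ` S" "dist p p" "dist p q" t] S t by auto
      then obtain x where x: "x \<in> S" "t = dist p x" by auto
      then obtain i where i: "x \<in> U i" using U by blast
      have bdd: "bdd_below (dist p ` U i)" by (rule bdd_belowI[of _ 0]) auto
      have "a i \<le> t" unfolding a_def x using i by (intro cINF_lower bdd) auto
      moreover have "t - diameter (U i) \<le> a i" unfolding a_def
      proof (rule cINF_greatest)
        fix y assume "y \<in> U i"
        hence "dist y x \<le> diameter (U i)" using U(2) i diameter_bounded_bound by blast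
        thus "t - diameter (U i) \<le> dist p y" using dist_triangle[of p x y] x by linarith
      qed (use i in auto)
      ultimately show "t \<in> (\<Union>i. I i)" using i by (auto simp: I_def intro!: exI[of _ i])
    qed
    have "ennreal (dist p q) = emeasure lborel {0..dist p q}" by simp
    also have "\<dots> \<le> emeasure lborel (\<Union>i. I i)" by (rule emeasure_mono[OF sub]) (auto simp: I_def)
    also have "\<dots> \<le> (\<Sum>i. emeasure lborel (I i))"
      by (rule emeasure_subadditive_countably) (auto simp: I_def)
    also have "\<dots> \<le> (\<Sum>i. ennreal (diameter (U i)))"
      by (rule suminf_le) (use U in \<open>auto simp: I_def diameter_ge_0\<close>)
    finally show "ennreal (dist p q) \<le> (\<Sum>i. ennreal (diameter (U i)))" .
  qed
  also have "\<dots> \<le> hausdorff1_outer S" by (rule hausdorff1_size_le_outer) simp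
  finally show ?thesis .
qed

text \<open>If a real coordinate \<open>p\<close> controls distances in \<open>A\<close>, then the preimages of
  small equal subintervals of its range form an efficient cover. This avoids inverting \<open>p\<close>.\<close>

lemma hausdorff1_outer_projection_le:
  fixes A :: "'a::metric_space set"
  assumes L: "L \<ge> 0" and ab: "a \<le> b" and p: "\<And>x. x \<in> A \<Longrightarrow> a \<le> p x \<and> p x \<le> b"
    and lip: "\<And>x y. x \<in> A \<Longrightarrow> y \<in> A \<Longrightarrow> dist x y \<le> L * \<bar>p x - p y\<bar>"
  shows "hausdorff1_outer A \<le> ennreal (L * (b - a))"
proof (rule hausdorff1_outer_finite_cover)
  fix \<delta> :: real assume d: "\<delta> > 0"
  obtain n :: nat where n: "L * (b - a) / \<delta> < real n" using reals_Archimedean2 by blast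
  have n0: "n > 0"
  proof (rule ccontr)
    assume "\<not> n > 0"
    hence "L * (b - a) / \<delta> < 0" using n by simp
    thus False using L ab d by (simp add: divide_less_0_iff mult_less_0_iff)
  qed
  define w where "w = (b - a) / n"
  have w: "w \<ge> 0" "n * w = b - a" using ab n0 by (auto simp: w_def)
  have Lw: "L * w \<le> \<delta>" using n n0 d by (simp add: w_def field_simps)
  define U where "U i = {x \<in> A. a + i * w \<le> p x \<and> p x \<le> a + (i + 1) * w}" for i :: nat
  have close: "dist x y \<le> L * w" if "x \<in> U i" "y \<in> U i" for x y i
  proof -
    have "\<bar>p x - p y\<bar> \<le> w" using that by (auto simp: U_def algebra_simps abs_le_iff)
    hence "L * \<bar>p x - p y\<bar> \<le> L * w" using L by (intro mult_left_mono)
    thus ?thesis using lip[of x y] that by (auto simp: U_def)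
  qed
  have diam: "diameter (U i) \<le> L * w" for i
    by (rule diameter_le_dist) (use close L w in auto)
  have bnd: "bounded (U i)" for i
    unfolding bounded_two_points using close by blast
  have cover: "A \<subseteq> (\<Union>i<n. U i)"
  proof
    fix x assume x: "x \<in> A"
    show "x \<in> (\<Union>i<n. U i)"
    proof (cases "w = 0")
      case True
      hence "p x = a" using p[OF x] w by auto
      thus ?thesis using x n0 True by (auto simp: U_def)
    next
      case False
      hence wp: "w > 0" using w by auto
      define i where "i = min (n - 1) (nat \<lfloor>(p x - a) / w\<rfloor>)"
      have q: "0 \<le> (p x - a) / w" "(p x - a) / w \<le> n"
        using p[OF x] wp w(2) by (auto simp: field_simps)
      have "real i \<le> (p x - a) / w"
        using q unfolding i_def by (simp add: min_def) linarith
      moreover have "(p x - a) / w \<le> real i + 1"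
      proof (cases "n - 1 \<le> nat \<lfloor>(p x - a) / w\<rfloor>")
        case True
        hence "real i + 1 = n" using n0 by (simp add: i_def)
        thus ?thesis using q by simp
      next
        case False
        hence "i = nat \<lfloor>(p x - a) / w\<rfloor>" by (simp add: i_def)
        thus ?thesis using q by linarith
      qed
      ultimately have "x \<in> U i" using x wp by (auto simp: U_def field_simps)
      moreover have "i < n" using n0 by (auto simp: i_def)
      ultimately show ?thesis by blast
    qed
  qed
  have "(\<Sum>i<n. diameter (U i)) \<le> (\<Sum>i<n. L * w)" by (rule sum_mono) (rule diam)
  also have "\<dots> = L * (n * w)" by simp
  also have "\<dots> = L * (b - a)" by (simp only: w(2))
  finally have "(\<Sum>i<n. diameter (U i)) \<le> L * (b - a)" .
  thus "\<exists>(n::nat) U. A \<subseteq> (\<Union>i<n. U i) \<and> (\<forall>i<n. bounded (U i) \<and> diameter (U i) \<le> \<delta>)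
     \<and> (\<Sum>i<n. diameter (U i)) \<le> L * (b - a)"
    using cover bnd diam Lw by (intro exI[of _ n] exI[of _ U]) (auto intro: order_trans)
qed

lemma hausdorff1_outer_lipschitz_image_le:
  fixes f :: "'a::metric_space \<Rightarrow> 'b::metric_space"
  assumes L: "L > 0" and lip: "\<And>x y. dist (f x) (f y) \<le> L * dist x y"
  shows "hausdorff1_outer (f ` A) \<le> ennreal L * hausdorff1_outer A"
proof (rule hausdorff1_outer_least)
  fix \<delta> :: real assume d: "\<delta> > 0"
  have "hausdorff1_size \<delta> (f ` A) \<le> ennreal L * (\<Sum>i. ennreal (diameter (U i)))"
    if U: "A \<subseteq> (\<Union>i. U i)" "\<And>i. bounded (U i)" "\<And>i. diameter (U i) \<le> \<delta> / L" for U
  proof -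
    have close: "dist (f x) (f y) \<le> L * diameter (U i)" if "x \<in> U i" "y \<in> U i" for x y i
    proof -
      have "dist x y \<le> diameter (U i)" using U(2) that diameter_bounded_bound by blast
      hence "L * dist x y \<le> L * diameter (U i)" using L by simp
      thus ?thesis using lip[of x y] by linarith
    qed
    have diam: "diameter (f ` U i) \<le> L * diameter (U i)" for i
      by (rule diameter_le_dist) (use close L U(2) in \<open>auto intro!: mult_nonneg_nonneg diameter_ge_0\<close>)
    have "hausdorff1_size \<delta> (f ` A) \<le> (\<Sum>i. ennreal (diameter (f ` U i)))"
    proof (rule hausdorff1_size_le)
      show "f ` A \<subseteq> (\<Union>i. f ` U i)" using U(1) by blast
      show "bounded (f ` U i)" for i unfolding bounded_two_points using close by blast
      show "diameter (f ` U i) \<le> \<delta>" for i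
        using diam[of i] U(3)[of i] L by (auto simp: field_simps intro: order_trans)
    qed
    also have "\<dots> \<le> (\<Sum>i. ennreal L * ennreal (diameter (U i)))"
      by (rule suminf_le) (use diam L in \<open>auto simp: ennreal_mult'[symmetric] intro!: ennreal_leI\<close>)
    also have "\<dots> = ennreal L * (\<Sum>i. ennreal (diameter (U i)))" by simp
    finally show ?thesis .
  qed
  hence "hausdorff1_size \<delta> (f ` A) / ennreal L \<le> hausdorff1_size (\<delta> / L) A"
    unfolding hausdorff1_size_def[of "\<delta> / L"]
    by (intro INF_greatest divide_le_posI_ennreal) (use L in auto)
  hence "ennreal L * (hausdorff1_size \<delta> (f ` A) / ennreal L) \<le> ennreal L * hausdorff1_size (\<delta> / L) A"
    by (rule mult_left_mono) simp
  also have "ennreal L * (hausdorff1_size \<delta> (f ` A) / ennreal L) = hausdorff1_size \<delta> (f ` A)"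
    using L by (simp add: mult.commute[of "ennreal L"] ennreal_divide_times)
  finally have "hausdorff1_size \<delta> (f ` A) \<le> ennreal L * hausdorff1_size (\<delta> / L) A" .
  also have "\<dots> \<le> ennreal L * hausdorff1_outer A"
    using d L by (intro mult_left_mono hausdorff1_size_le_outer) auto
  finally show "hausdorff1_size \<delta> (f ` A) \<le> ennreal L * hausdorff1_outer A" .
qed

section \<open>Wirtinger's inequality\<close>

text \<open>For \<open>z < 1\<close> and \<open>k = sqrt z\<close>, the function \<open>k tan (k (t -
  c))\<close> is smooth on the closed interval, and \<open>f'^2 - z f^2\<close> is a square minus the derivative
  of \<open>k tan (k (t - c)) f^2\<close>, which integrates to zero since \<open>f\<close> vanishes at both
  ends. Taking \<open>z < 1\<close> first avoids the poles of \<open>tan\<close> that appear for \<open>z =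
  1\<close>.\<close>

lemma wirtinger_half_period:
  fixes f f' :: "real \<Rightarrow> real"
  assumes f: "\<And>t. (f has_real_derivative f' t) (at t)" and f': "continuous_on UNIV f'"
    and zero: "f (c - pi/2) = 0" "f (c + pi/2) = 0"
  shows "integral {c - pi/2..c + pi/2} (\<lambda>t. (f t)\<^sup>2) \<le> integral {c - pi/2..c + pi/2} (\<lambda>t. (f' t)\<^sup>2)"
proof (rule field_le_mult_one_interval)
  fix z :: real assume z: "0 < z" "z < 1"
  define k where "k = sqrt z"
  have k: "0 < k" "k < 1" "k\<^sup>2 = z" using z by (auto simp: k_def real_sqrt_lt_1_iff)
  let ?I = "{c - pi/2..c + pi/2}"
  note f'_cont = continuous_on_subset[OF f' subset_UNIV]
  have f_cont: "continuous_on S f" for S using f DERIV_isCont continuous_at_imp_continuous_on by blast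
  have cos_pos: "cos (k * (t - c)) > 0" if "t \<in> ?I" for t
  proof -
    have "k * (t - c) \<le> k * (pi/2)" "- (k * (pi/2)) \<le> k * (t - c)"
      using that k mult_left_mono[of "t - c" "pi/2" k] mult_left_mono[of "- (pi/2)" "t - c" k] by simp_all
    moreover have "k * (pi/2) < 1 * (pi/2)" using k by (intro mult_strict_right_mono) auto
    ultimately show ?thesis by (intro cos_gt_zero_pi; linarith)
  qed
  define g where "g t = k * tan (k * (t - c)) * (f t)\<^sup>2" for t
  define g' where "g' t = k\<^sup>2 * (1 + (tan (k * (t - c)))\<^sup>2) * (f t)\<^sup>2 + 2 * k * tan (k * (t - c)) * f t * f' t" for t
  have "(g has_real_derivative g' t) (at t)" if t: "t \<in> ?I" for t
  proof -
    have "cos (k * (t - c)) \<noteq> 0" using cos_pos[OF t] by simp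
    hence "((\<lambda>t. tan (k * (t - c))) has_real_derivative (1 + (tan (k * (t - c)))\<^sup>2) * k) (at t)"
      by (auto intro!: derivative_eq_intros simp: tan_sec power_inverse)
    from DERIV_mult[OF DERIV_cmult[OF this, of k] DERIV_power[OF f, of 2]]
    show ?thesis unfolding g_def g'_def
      by (rule DERIV_cong) (simp add: power2_eq_square algebra_simps)
  qed
  hence "(g' has_integral (g (c + pi/2) - g (c - pi/2))) ?I"
    by (intro fundamental_theorem_of_calculus)
       (auto simp: has_real_derivative_iff_has_vector_derivative[symmetric] intro: has_field_derivative_at_within)
  hence g'_int: "(g' has_integral 0) ?I" by (simp add: g_def zero)
  have i1: "(\<lambda>t. (f' t)\<^sup>2) integrable_on ?I" by (intro integrable_continuous_real continuous_intros f'_cont)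
  have i2: "(\<lambda>t. z * (f t)\<^sup>2) integrable_on ?I" by (intro integrable_continuous_real continuous_intros f_cont)
  have "integral ?I (\<lambda>t. z * (f t)\<^sup>2) = integral ?I (\<lambda>t. z * (f t)\<^sup>2 - g' t)"
    using g'_int i2 by (subst integral_diff) (auto simp: has_integral_iff)
  also have "\<dots> \<le> integral ?I (\<lambda>t. (f' t)\<^sup>2)"
  proof (rule integral_le)
    show "(\<lambda>t. z * (f t)\<^sup>2 - g' t) integrable_on ?I"
      using g'_int i2 by (intro integrable_diff) auto
    fix t
    \<comment> \<open>The square is that of \<open>cos (k (t - c))\<close> times the derivative of \<open>f t / cos (k (t - c))\<close>.\<close>
    have "(f' t)\<^sup>2 - (z * (f t)\<^sup>2 - g' t) = (f' t + k * tan (k * (t - c)) * f t)\<^sup>2"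
      unfolding g'_def k(3)[symmetric] by (simp add: power2_eq_square algebra_simps)
    thus "z * (f t)\<^sup>2 - g' t \<le> (f' t)\<^sup>2" by (metis diff_ge_0_iff_ge zero_le_power2)
  qed (rule i1)
  finally show "z * integral ?I (\<lambda>t. (f t)\<^sup>2) \<le> integral ?I (\<lambda>t. (f' t)\<^sup>2)" by simp
qed

text \<open>By the intermediate value theorem there is an \<open>a\<close> with \<open>f a = f (a +
  \<pi>)\<close>. Subtracting this common value makes \<open>f\<close> vanish at \<open>a\<close>, \<open>a +
  \<pi>\<close> and \<open>a + 2 \<pi>\<close>, and the half-period inequality applies twice. Replacing the
  value by the mean of \<open>f\<close> can only decrease the left-hand side. The period starts at this
  \<open>a\<close>, which is why the conclusion is existential.\<close>

lemma wirtinger_periodic: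
  fixes f f' :: "real \<Rightarrow> real"
  assumes f: "\<And>t. (f has_real_derivative f' t) (at t)" and f': "continuous_on UNIV f'"
    and per: "\<And>t. f (t + 2 * pi) = f t"
  shows "\<exists>a. integral {a..a + 2 * pi} (\<lambda>t. (f t)\<^sup>2) - (integral {a..a + 2 * pi} f)\<^sup>2 / (2 * pi)
           \<le> integral {a..a + 2 * pi} (\<lambda>t. (f' t)\<^sup>2)"
proof -
  note f'_cont = continuous_on_subset[OF f' subset_UNIV]
  have f_cont: "continuous_on S f" for S using f DERIV_isCont continuous_at_imp_continuous_on by blast
  define g where "g t = f (t + pi) - f t" for t
  have g_cont: "continuous_on {0..pi} g" unfolding g_def
    by (intro continuous_intros continuous_on_compose2[OF f_cont[of UNIV]]) auto
  have "g pi = - g 0" using per[of 0] by (simp add: g_def)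
  then obtain a where a: "g a = 0"
    using IVT'[of g 0 0 pi] IVT2'[of g pi 0 0] g_cont by (cases "g 0 \<le> 0") force+
  define v where "v = f a"
  have fv: "f a = v" "f (a + pi) = v" "f (a + 2 * pi) = v" using a per[of a] by (auto simp: g_def v_def)
  have int2: "(\<lambda>t. (f t - v)\<^sup>2) integrable_on {x..y}" "(\<lambda>t. (f' t)\<^sup>2) integrable_on {x..y}"
    "f integrable_on {x..y}" "(\<lambda>t. (f t)\<^sup>2) integrable_on {x..y}" for x y
    by (intro integrable_continuous_real continuous_intros f_cont f'_cont)+
  have f_v: "((\<lambda>t. f t - v) has_real_derivative f' t) (at t)" for t
    by (auto intro!: derivative_eq_intros f)
  have half: "integral {x..x + pi} (\<lambda>t. (f t - v)\<^sup>2) \<le> integral {x..x + pi} (\<lambda>t. (f' t)\<^sup>2)"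
    if "f x = v" "f (x + pi) = v" for x
    using wirtinger_half_period[OF f_v f', of "x + pi/2"] that by (simp add: add.commute)
  let ?I = "{a..a + 2 * pi}"
  have "integral ?I (\<lambda>t. (f t - v)\<^sup>2) = integral {a..a+pi} (\<lambda>t. (f t - v)\<^sup>2) + integral {a+pi..a+pi+pi} (\<lambda>t. (f t - v)\<^sup>2)"
    using Henstock_Kurzweil_Integration.integral_combine[of a "a+pi" "a+2*pi" "\<lambda>t. (f t - v)\<^sup>2"] int2
    by (simp add: algebra_simps)
  also have "\<dots> \<le> integral {a..a+pi} (\<lambda>t. (f' t)\<^sup>2) + integral {a+pi..a+pi+pi} (\<lambda>t. (f' t)\<^sup>2)"
    using fv by (intro add_mono half) (auto simp: algebra_simps)
  also have "\<dots> = integral ?I (\<lambda>t. (f' t)\<^sup>2)"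
    using Henstock_Kurzweil_Integration.integral_combine[of a "a+pi" "a+2*pi" "\<lambda>t. (f' t)\<^sup>2"] int2
    by (simp add: algebra_simps)
  finally have 1: "integral ?I (\<lambda>t. (f t - v)\<^sup>2) \<le> integral ?I (\<lambda>t. (f' t)\<^sup>2)" .
  have "integral ?I (\<lambda>t. (f t - v)\<^sup>2) = integral ?I (\<lambda>t. (f t)\<^sup>2 - 2 * v * f t + v\<^sup>2)"
    by (simp add: power2_eq_square algebra_simps)
  also have "\<dots> = integral ?I (\<lambda>t. (f t)\<^sup>2) - 2 * v * integral ?I f + v\<^sup>2 * (2 * pi)"
    using has_integral_const_real[of "v\<^sup>2" a "a + 2 * pi"]
    by (intro integral_unique has_integral_add has_integral_diff has_integral_mult_right integrable_integral int2)
       (simp add: mult.commute)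
  also have "\<dots> = integral ?I (\<lambda>t. (f t)\<^sup>2) - (integral ?I f)\<^sup>2 / (2 * pi)
      + (integral ?I f - 2 * pi * v)\<^sup>2 / (2 * pi)"
    by (simp add: power2_eq_square field_simps)
  finally have "integral ?I (\<lambda>t. (f t)\<^sup>2) - (integral ?I f)\<^sup>2 / (2 * pi) \<le> integral ?I (\<lambda>t. (f t - v)\<^sup>2)"
    by simp
  with 1 show ?thesis by (intro exI[of _ a]) linarith
qed

section \<open>Solutions of the differential equation\<close>

text \<open>Here \<open>w\<close> is the curvature, the reciprocal of \<open>h2 + h\<close>; the last claim
  makes \<open>w + h\<close> a first integral of the equation.\<close>

lemma curvature_of_solution:
  fixes h h1 h2 :: "real \<Rightarrow> real" and c :: real
  assumes c: "c > 0" and h: "\<And>t. (h has_real_derivative h1 t) (at t)"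
    and h1: "\<And>t. (h1 has_real_derivative h2 t) (at t)"
    and eq: "\<And>t. exp (- ((h1 t)\<^sup>2 + (h t)\<^sup>2) / 2) * (h2 t + h t) = c"
  defines "w \<equiv> \<lambda>t. exp (- ((h1 t)\<^sup>2 + (h t)\<^sup>2) / 2) / c"
  shows "w t > 0" "h2 t + h t = 1 / w t" "(w has_real_derivative - h1 t) (at t)"
proof -
  show "w t > 0" using c by (simp add: w_def)
  show 2: "h2 t + h t = 1 / w t" using eq[of t] c by (simp add: w_def field_simps)
  have "(w has_real_derivative exp (- ((h1 t)\<^sup>2 + (h t)\<^sup>2) / 2) * (- (h1 t * h2 t + h t * h1 t)) / c) (at t)"
    unfolding w_def using c by (auto intro!: derivative_eq_intros h h1 simp: field_simps)
  also have "exp (- ((h1 t)\<^sup>2 + (h t)\<^sup>2) / 2) * (- (h1 t * h2 t + h t * h1 t)) / c = - h1 t * (w t * (h2 t + h t))"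
    using c by (simp add: w_def field_simps)
  also have "w t * (h2 t + h t) = 1" unfolding 2 using \<open>w t > 0\<close> by simp
  finally show "(w has_real_derivative - h1 t) (at t)" by simp
qed

text \<open>The argument is Wirtinger's inequality for the curvature \<open>w\<close> against the
  Cauchy--Schwarz inequality for \<open>w\<close> and \<open>1 / w\<close>: the former yields \<open>W * V \<le>
  (2 * \<pi>)\<^sup>2\<close> and the latter the reverse inequality.\<close>

lemma periodic_solution_constant:
  fixes h h1 h2 :: "real \<Rightarrow> real" and c :: real
  assumes c: "c > 0" and h: "\<And>t. (h has_real_derivative h1 t) (at t)"
    and h1: "\<And>t. (h1 has_real_derivative h2 t) (at t)"
    and eq: "\<And>t. exp (- ((h1 t)\<^sup>2 + (h t)\<^sup>2) / 2) * (h2 t + h t) = c"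
    and per: "\<And>t. h (t + 2 * pi) = h t"
  shows "\<exists>r. \<forall>t. h t = r"
proof -
  define w where "w t = exp (- ((h1 t)\<^sup>2 + (h t)\<^sup>2) / 2) / c" for t
  note w = curvature_of_solution[OF c h h1 eq, folded w_def]
  have per1: "h1 (t + 2 * pi) = h1 t" for t
  proof -
    have "((\<lambda>t. h (t + 2 * pi)) has_real_derivative h1 (t + 2 * pi)) (at t)"
      using h[of "t + 2 * pi"] by (simp add: DERIV_shift)
    thus ?thesis using h[of t] per DERIV_unique by auto
  qed
  have "((\<lambda>t. w t + h t) has_real_derivative 0) (at t)" for t
    using DERIV_add[OF w(3) h] by simp
  then obtain A where A: "\<And>t. w t + h t = A" using DERIV_isconst_all by metis
  have h_w: "h t = A - w t" for t using A[of t] by simp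
  have cont_h: "continuous_on S h" for S using h DERIV_isCont continuous_at_imp_continuous_on by blast
  have cont_h1: "continuous_on S h1" for S using h1 DERIV_isCont continuous_at_imp_continuous_on by blast
  have cont_w: "continuous_on S w" for S using w(3) DERIV_isCont continuous_at_imp_continuous_on by blast
  have cont_inv: "continuous_on S (\<lambda>t. 1 / w t)" for S
    by (intro continuous_intros cont_w) (use w(1) less_imp_neq in fastforce)
  have w_per: "w (t + 2 * pi) = w t" for t by (simp add: w_def per per1)
  obtain a where a: "integral {a..a + 2 * pi} (\<lambda>t. (w t)\<^sup>2) - (integral {a..a + 2 * pi} w)\<^sup>2 / (2 * pi)
           \<le> integral {a..a + 2 * pi} (\<lambda>t. (- h1 t)\<^sup>2)"
    using wirtinger_periodic[of w "\<lambda>t. - h1 t"] w(3) w_per cont_h1[of UNIV] by (auto intro: continuous_on_minus)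
  let ?I = "{a..a + 2 * pi}"
  define W where "W = integral ?I w"
  define V where "V = integral ?I (\<lambda>t. 1 / w t)"
  define W2 where "W2 = integral ?I (\<lambda>t. (w t)\<^sup>2)"
  define D2 where "D2 = integral ?I (\<lambda>t. (h1 t)\<^sup>2)"
  have iw: "(w has_integral W) ?I" unfolding W_def
    by (intro integrable_integral integrable_continuous_real cont_w)
  have iv: "((\<lambda>t. 1 / w t) has_integral V) ?I" unfolding V_def
    by (intro integrable_integral integrable_continuous_real cont_inv)
  have iw2: "((\<lambda>t. (w t)\<^sup>2) has_integral W2) ?I" unfolding W2_def
    by (intro integrable_integral integrable_continuous_real continuous_intros cont_w)
  have id2: "((\<lambda>t. (h1 t)\<^sup>2) has_integral D2) ?I" unfolding D2_def
    by (intro integrable_integral integrable_continuous_real continuous_intros cont_h1)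
  have ic: "((\<lambda>t. x) has_integral (2 * pi * x)) ?I" for x :: real
    using has_integral_const_real[of x a "a + 2 * pi"] by simp
  have "(h2 has_integral (h1 (a + 2 * pi) - h1 a)) ?I"
    by (intro fundamental_theorem_of_calculus)
       (auto simp: has_real_derivative_iff_has_vector_derivative[symmetric] intro: has_field_derivative_at_within h1)
  moreover have "h2 = (\<lambda>t. (1 / w t - A) + w t)"
    using w(2) h_w by (auto simp: fun_eq_iff algebra_simps)
  ultimately have "((\<lambda>t. (1 / w t - A) + w t) has_integral 0) ?I" by (simp add: per1)
  from has_integral_unique[OF this] have unique0: "((\<lambda>t. (1 / w t - A) + w t) has_integral x) ?I \<Longrightarrow> x = 0" for x
    by auto
  have "((\<lambda>t. (1 / w t - A) + w t) has_integral (V - 2 * pi * A + W)) ?I"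
    by (intro has_integral_add has_integral_diff iv iw ic)
  from unique0[OF this] have V: "V = 2 * pi * A - W" by simp
  have "((\<lambda>t. w t * h1 t) has_real_derivative (1 - A * w t + (w t)\<^sup>2 - (h1 t)\<^sup>2)) (at t)" for t
  proof -
    have "w t * (h2 t + h t) = 1" using w(1,2)[of t] by simp
    hence "- h1 t * h1 t + h2 t * w t = 1 - A * w t + (w t)\<^sup>2 - (h1 t)\<^sup>2"
      by (simp add: h_w power2_eq_square algebra_simps)
    thus ?thesis using DERIV_mult[OF w(3)[of t] h1[of t]] by simp
  qed
  hence "((\<lambda>t. 1 - A * w t + (w t)\<^sup>2 - (h1 t)\<^sup>2) has_integral (w (a + 2 * pi) * h1 (a + 2 * pi) - w a * h1 a)) ?I"
    by (intro fundamental_theorem_of_calculus)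
       (auto simp: has_real_derivative_iff_has_vector_derivative[symmetric] intro: has_field_derivative_at_within)
  hence "((\<lambda>t. 1 - A * w t + (w t)\<^sup>2 - (h1 t)\<^sup>2) has_integral 0) ?I" by (simp add: per1 w_per)
  from has_integral_unique[OF this]
  have unique1: "((\<lambda>t. 1 - A * w t + (w t)\<^sup>2 - (h1 t)\<^sup>2) has_integral x) ?I \<Longrightarrow> x = 0" for x by auto
  have "((\<lambda>t. 1 - A * w t + (w t)\<^sup>2 - (h1 t)\<^sup>2) has_integral (2 * pi * 1 - A * W + W2 - D2)) ?I"
    by (intro has_integral_add has_integral_diff has_integral_mult_right iw iw2 id2 ic)
  from unique1[OF this] have "2 * pi - A * W + W2 - D2 = 0" by simp
  moreover have "W2 - W\<^sup>2 / (2 * pi) \<le> D2" using a by (simp add: W2_def W_def D2_def)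
  ultimately have "A * W - 2 * pi \<le> W\<^sup>2 / (2 * pi)" by linarith
  hence "(A * W - 2 * pi) * (2 * pi) \<le> W\<^sup>2" by (simp add: pos_le_divide_eq)
  hence WV: "W * V \<le> (2 * pi)\<^sup>2" unfolding V by (simp add: power2_eq_square algebra_simps)
  define m where "m = W / (2 * pi)"
  have W_m: "W = 2 * pi * m" by (simp add: m_def)
  have "W \<ge> 0" using iw by (rule has_integral_nonneg) (use w(1) less_imp_le in blast)
  hence "m \<ge> 0" by (simp add: m_def)
  \<comment> \<open>Cauchy--Schwarz with its equality case: the integrand is \<open>(w - m)^2 / w\<close>, with \<open>m\<close> the mean of \<open>w\<close>.\<close>
  have "((\<lambda>t. w t - 2 * m + m\<^sup>2 * (1 / w t)) has_integral (W - 2 * pi * (2 * m) + m\<^sup>2 * V)) ?I"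
    by (intro has_integral_add has_integral_diff has_integral_mult_right iw iv ic)
  also have "(\<lambda>t. w t - 2 * m + m\<^sup>2 * (1 / w t)) = (\<lambda>t. (w t - m)\<^sup>2 / w t)"
  proof
    fix t show "w t - 2 * m + m\<^sup>2 * (1 / w t) = (w t - m)\<^sup>2 / w t"
      using w(1)[of t] by (simp add: field_simps power2_eq_square)
  qed
  finally have int0: "((\<lambda>t. (w t - m)\<^sup>2 / w t) has_integral (W - 2 * pi * (2 * m) + m\<^sup>2 * V)) ?I" .
  have "W - 2 * pi * (2 * m) + m\<^sup>2 * V \<le> 0"
  proof -
    have "2 * pi * (m * V) \<le> 2 * pi * (2 * pi)" using WV by (simp add: W_m power2_eq_square mult_ac)
    hence "m * V \<le> 2 * pi" by (simp add: mult.commute)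
    hence "m * (m * V) \<le> m * (2 * pi)" using \<open>m \<ge> 0\<close> by (rule mult_left_mono)
    thus ?thesis by (simp add: W_m power2_eq_square algebra_simps)
  qed
  moreover have "W - 2 * pi * (2 * m) + m\<^sup>2 * V \<ge> 0"
    using int0 by (rule has_integral_nonneg) (use w(1) less_imp_le in \<open>auto intro!: divide_nonneg_nonneg\<close>)
  ultimately have "integral ?I (\<lambda>t. (w t - m)\<^sup>2 / w t) = 0" using int0 by (simp add: integral_unique)
  moreover have "continuous_on ?I (\<lambda>t. (w t - m)\<^sup>2 / w t)"
    by (intro continuous_intros cont_w) (use w(1) less_imp_neq in fastforce)
  moreover have "0 \<le> (w t - m)\<^sup>2 / w t" for t using w(1)[of t] by simp
  ultimately have sq0: "(w t - m)\<^sup>2 / w t = 0" if "t \<in> ?I" for t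
    using integral_eq_0_iff[of a "a + 2 * pi" "\<lambda>t. (w t - m)\<^sup>2 / w t"] that pi_gt_zero by simp
  have wm: "w t = m" if "t \<in> ?I" for t using sq0[OF that] w(1)[of t] by simp
  interpret periodic_fun_simple h "2 * pi" by standard (rule per)
  have "h t = A - m" for t
  proof -
    define n where "n = \<lfloor>(t - a) / (2 * pi)\<rfloor>"
    have "of_int n \<le> (t - a) / (2 * pi)" "(t - a) / (2 * pi) < of_int n + 1" unfolding n_def by linarith+
    hence "t - of_int n * (2 * pi) \<in> ?I" by (simp add: field_simps)
    hence "h (t - of_int n * (2 * pi)) = A - m" using h_w wm by simp
    thus ?thesis by (simp add: minus_of_int)
  qed
  thus ?thesis by blast
qed

lemma nonneg_solution_const_iff:
  "nonneg_solution C (\<lambda>_. r) \<longleftrightarrow> r \<ge> 0 \<and> r * exp (- r\<^sup>2 / 2) = 2 * pi * C"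
  by (auto simp: nonneg_solution_def field_simps)

lemma nonneg_solution_constant:
  assumes "C > 0" "nonneg_solution C h"
  obtains r where "h = (\<lambda>_. r)"
proof -
  have "\<exists>r. \<forall>t. h t = r"
  proof (rule periodic_solution_constant)
    show "2 * pi * C > 0" using assms by simp
    show "(h has_real_derivative deriv h t) (at t)" for t
      using assms by (simp add: nonneg_solution_def DERIV_deriv_iff_real_differentiable)
    show "(deriv h has_real_derivative deriv (deriv h) t) (at t)" for t
      using assms by (simp add: nonneg_solution_def DERIV_deriv_iff_real_differentiable)
    show "h (t + 2 * pi) = h t" for t using assms by (simp add: nonneg_solution_def)
    show "exp (- ((deriv h t)\<^sup>2 + (h t)\<^sup>2) / 2) * (deriv (deriv h) t + h t) = 2 * pi * C" for t
      using assms by (auto simp: nonneg_solution_def field_simps)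
  qed
  thus ?thesis using that by blast
qed

lemma nonneg_solutions_eq:
  assumes "C > 0"
  shows "{h. nonneg_solution C h} = (\<lambda>r _. r) ` {r. r \<ge> 0 \<and> r * exp (- r\<^sup>2 / 2) = 2 * pi * C}"
proof (intro equalityI subsetI)
  fix h assume "h \<in> {h. nonneg_solution C h}"
  hence h: "nonneg_solution C h" by simp
  then obtain r where "h = (\<lambda>_. r)" using nonneg_solution_constant[OF assms] by metis
  with h nonneg_solution_const_iff[of C r]
  show "h \<in> (\<lambda>r _. r) ` {r. r \<ge> 0 \<and> r * exp (- r\<^sup>2 / 2) = 2 * pi * C}" by simp
qed (clarsimp simp: nonneg_solution_const_iff)

text \<open>The Gaussian surface area measure of the disk of radius \<open>r\<close> has density
  \<open>radial_density r / (2 * \<pi>)\<close> with respect to arc length of the circle.\<close>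

definition radial_density :: "real \<Rightarrow> real" where
  "radial_density r = r * exp (- r\<^sup>2 / 2)"

lemma radial_density_deriv:
  "(radial_density has_real_derivative (1 - r\<^sup>2) * exp (- r\<^sup>2 / 2)) (at r)"
  unfolding radial_density_def
  by (auto intro!: derivative_eq_intros simp: power2_eq_square algebra_simps)

lemma radial_density_strict_mono:
  assumes "0 \<le> x" "x < y" "y \<le> 1" shows "radial_density x < radial_density y"
proof (rule DERIV_pos_imp_increasing_open[OF assms(2)])
  fix r assume "x < r" "r < y"
  hence "r\<^sup>2 < 1" using assms by (simp add: power_less_one_iff abs_square_less_1)
  thus "\<exists>d. (radial_density has_real_derivative d) (at r) \<and> d > 0"
    using radial_density_deriv by (intro exI conjI) (auto intro!: mult_pos_pos)
qed (use radial_density_deriv DERIV_isCont continuous_at_imp_continuous_on in blast)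

lemma radial_density_strict_antimono:
  assumes "1 \<le> x" "x < y" shows "radial_density y < radial_density x"
proof (rule DERIV_neg_imp_decreasing_open[OF assms(2)])
  fix r assume "x < r" "r < y"
  hence "r\<^sup>2 > 1" using assms by (simp add: one_less_power)
  thus "\<exists>d. (radial_density has_real_derivative d) (at r) \<and> d < 0"
    using radial_density_deriv by (intro exI conjI) (auto intro!: mult_neg_pos)
qed (use radial_density_deriv DERIV_isCont continuous_at_imp_continuous_on in blast)

lemma radial_density_1: "radial_density 1 = exp (-1/2)"
  by (simp add: radial_density_def)

lemma radial_density_less_1: "r \<ge> 0 \<Longrightarrow> r \<noteq> 1 \<Longrightarrow> radial_density r < exp (-1/2)"
  using radial_density_strict_mono[of r 1] radial_density_strict_antimono[of 1 r]
  by (cases "r < 1") (auto simp: radial_density_1)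

text \<open>One solution lies on the increasing branch \<open>[0, 1]\<close> and one on the decreasing branch
  \<open>[1, \<infinity>)\<close>; at \<open>M = 1 + 2 / c\<close> the function is already at most
  \<open>c\<close>, as \<open>radial_density M \<le> 2 / M\<close>.\<close>

lemma card_radial_density_level:
  assumes "0 < c" "c < exp (-1/2)"
  shows "card {r. r \<ge> 0 \<and> radial_density r = c} = 2"
proof -
  have cont: "continuous_on S radial_density" for S
    using radial_density_deriv DERIV_isCont continuous_at_imp_continuous_on by blast
  obtain r1 where r1: "0 \<le> r1" "r1 \<le> 1" "radial_density r1 = c"
    using IVT'[of radial_density 0 c 1] assms cont by (auto simp: radial_density_1) (auto simp: radial_density_def)
  define M where "M = 1 + 2 / c"
  have M: "M \<ge> 1" using assms by (simp add: M_def)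
  have "radial_density M \<le> c"
  proof -
    have "M\<^sup>2 / 2 \<le> exp (M\<^sup>2 / 2)" using exp_ge_add_one_self[of "M\<^sup>2 / 2"] by linarith
    hence "M * exp (- M\<^sup>2 / 2) \<le> M * (2 / M\<^sup>2)"
      using M by (simp add: exp_minus field_simps)
    also have "\<dots> = 2 / M" using M by (simp add: power2_eq_square)
    also have "\<dots> \<le> c" using assms M by (simp add: M_def field_simps)
    finally show ?thesis by (simp add: radial_density_def)
  qed
  then obtain r2 where r2: "1 \<le> r2" "radial_density r2 = c"
    using IVT2'[of radial_density M c 1] assms cont M by (auto simp: radial_density_1)
  have ne: "r1 \<noteq> 1" "r2 \<noteq> 1" using r1 r2 assms radial_density_1 by auto
  have "{r. r \<ge> 0 \<and> radial_density r = c} = {r1, r2}"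
  proof (intro equalityI subsetI)
    fix r assume r: "r \<in> {r. r \<ge> 0 \<and> radial_density r = c}"
    show "r \<in> {r1, r2}"
    proof (cases "r \<le> 1")
      case True
      thus ?thesis using r r1 radial_density_strict_mono[of r r1] radial_density_strict_mono[of r1 r]
        by (cases r r1 rule: linorder_cases) auto
    next
      case False
      thus ?thesis using r r2 radial_density_strict_antimono[of r r2] radial_density_strict_antimono[of r2 r]
        by (cases r r2 rule: linorder_cases) auto
    qed
  qed (use r1 r2 in auto)
  moreover have "r1 \<noteq> r2" using r1 r2 ne by auto
  ultimately show ?thesis by simp
qed

lemma count_nonneg_solutions:
  assumes "C > 0"
  shows "C < exp (-1/2) / (2 * pi) \<Longrightarrow> card {h. nonneg_solution C h} = 2"
    and "C = exp (-1/2) / (2 * pi) \<Longrightarrow> \<exists>!h. nonneg_solution C h"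
    and "C > exp (-1/2) / (2 * pi) \<Longrightarrow> \<not> (\<exists>h. nonneg_solution C h)"
proof -
  define S where "S = {r. r \<ge> 0 \<and> radial_density r = 2 * pi * C}"
  have eq: "{h. nonneg_solution C h} = (\<lambda>r _. r) ` S"
    using nonneg_solutions_eq[OF assms] by (simp add: S_def radial_density_def)
  have inj: "inj_on (\<lambda>r (_::real). r) S" by (auto simp: inj_on_def fun_eq_iff)
  show "card {h. nonneg_solution C h} = 2" if "C < exp (-1/2) / (2 * pi)"
    unfolding eq card_image[OF inj] unfolding S_def
    by (rule card_radial_density_level) (use that assms in \<open>auto simp: field_simps\<close>)
  show "\<exists>!h. nonneg_solution C h" if "C = exp (-1/2) / (2 * pi)"
  proof -
    have "2 * pi * C = exp (-1/2)" using that by simp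
    hence "S = {1}" using radial_density_less_1 by (force simp: S_def radial_density_1)
    hence "{h. nonneg_solution C h} = {\<lambda>_. 1}" by (simp add: eq)
    thus ?thesis by (metis (mono_tags, lifting) mem_Collect_eq singletonD singletonI)
  qed
  show "\<not> (\<exists>h. nonneg_solution C h)" if "C > exp (-1/2) / (2 * pi)"
  proof -
    have "2 * pi * C > exp (-1/2)" using that by (simp add: field_simps)
    hence "S = {}" using radial_density_less_1 radial_density_1 by (force simp: S_def)
    thus ?thesis using eq by auto
  qed
qed

section \<open>Planar geometry in polar coordinates\<close>

text \<open>Throughout, \<open>unit_vec (t + pi/2)\<close> serves as the unit tangent at the point of the
  boundary with outer normal \<open>unit_vec t\<close>.\<close>

lemma unit_vec_nth [simp]: "unit_vec t $ 1 = cos t" "unit_vec t $ 2 = sin t"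
  by (simp_all add: unit_vec_def vector_2)

lemma inner_unit_vec: "x \<bullet> unit_vec t = x $ 1 * cos t + x $ 2 * sin t"
  by (simp add: inner_vec_def sum_2)

lemma inner_unit_vec_unit_vec: "unit_vec s \<bullet> unit_vec t = cos (s - t)"
  by (simp add: inner_unit_vec cos_diff)

lemma norm_unit_vec [simp]: "norm (unit_vec t) = 1"
  by (simp add: norm_eq_sqrt_inner inner_unit_vec_unit_vec)

lemma unit_vec_periodic [simp]: "unit_vec (t + 2 * pi) = unit_vec t"
  by (simp add: unit_vec_def)

lemma unit_vec_pi: "unit_vec (t + pi) = - unit_vec t"
  by (simp add: vec_eq_iff forall_2)

lemma unit_vec_surj:
  assumes "norm u = 1" obtains t where "u = unit_vec t"
proof -
  have "(u $ 1)\<^sup>2 + (u $ 2)\<^sup>2 = 1"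
    using assms by (simp add: norm_eq_sqrt_inner inner_vec_def sum_2 power2_eq_square)
  then obtain t where "u $ 1 = cos t" "u $ 2 = sin t" using sincos_total_2pi by metis
  thus ?thesis using that by (simp add: vec_eq_iff forall_2)
qed

lemma has_vector_derivative_unit_vec:
  "(unit_vec has_vector_derivative unit_vec (t + pi/2)) (at t)"
proof -
  have "((\<lambda>t. cos t *\<^sub>R axis 1 1 + sin t *\<^sub>R axis 2 (1::real) :: real^2)
      has_vector_derivative (- sin t *\<^sub>R axis 1 1 + cos t *\<^sub>R axis 2 1)) (at t)"
    by (auto intro!: derivative_eq_intros)
  also have "(\<lambda>t. cos t *\<^sub>R axis 1 1 + sin t *\<^sub>R axis 2 (1::real) :: real^2) = unit_vec"
    by (auto simp: fun_eq_iff vec_eq_iff forall_2 axis_def)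
  also have "- sin t *\<^sub>R axis 1 1 + cos t *\<^sub>R axis 2 (1::real) = unit_vec (t + pi/2)"
    by (auto simp: vec_eq_iff forall_2 axis_def cos_add sin_add)
  finally show ?thesis .
qed

lemma continuous_on_unit_vec: "continuous_on S unit_vec"
  by (meson continuous_at_imp_continuous_on has_vector_derivative_continuous has_vector_derivative_unit_vec)

lemma norm_sq_polar: "(norm x)\<^sup>2 = (x \<bullet> unit_vec t)\<^sup>2 + (x \<bullet> unit_vec (t + pi/2))\<^sup>2"
proof -
  have "(x \<bullet> unit_vec t)\<^sup>2 + (x \<bullet> unit_vec (t + pi/2))\<^sup>2
      = ((x $ 1)\<^sup>2 + (x $ 2)\<^sup>2) * ((sin t)\<^sup>2 + (cos t)\<^sup>2)"
    by (simp only: inner_unit_vec cos_add sin_add cos_pi_half sin_pi_half) algebra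
  moreover have "(norm x)\<^sup>2 = (x $ 1)\<^sup>2 + (x $ 2)\<^sup>2"
    unfolding power2_norm_eq_inner by (simp add: inner_vec_def sum_2 power2_eq_square)
  ultimately show ?thesis by simp
qed

text \<open>If \<open>v\<close> is the chord from the boundary point with normal angle \<open>a\<close> to the
  one with normal angle \<open>b\<close>, then the support inequalities are exactly the hypotheses on
  \<open>v\<close>, and \<open>v\<close> lies in the cone spanned by the two tangents.\<close>

lemma chord_in_tangent_cone:
  assumes ab: "a < b" "b - a < pi" and v: "v \<bullet> unit_vec a \<le> 0" "0 \<le> v \<bullet> unit_vec b"
  obtains l m where "l \<ge> 0" "m \<ge> 0" "v = l *\<^sub>R unit_vec (a + pi/2) + m *\<^sub>R unit_vec (b + pi/2)"
proof -
  have s: "sin (b - a) > 0" using ab by (intro sin_gt_zero) auto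
  define l where "l = (v \<bullet> unit_vec b) / sin (b - a)"
  define m where "m = - (v \<bullet> unit_vec a) / sin (b - a)"
  have ls: "l * sin (b - a) = v $ 1 * cos b + v $ 2 * sin b"
    and ms: "m * sin (b - a) = - (v $ 1 * cos a + v $ 2 * sin a)"
    using s by (simp_all add: l_def m_def inner_unit_vec)
  have "v $ 1 * sin (b - a) = (- l * sin a - m * sin b) * sin (b - a)"
    using ls ms unfolding left_diff_distrib
    by (simp add: sin_diff algebra_simps) algebra
  moreover have "v $ 2 * sin (b - a) = (l * cos a + m * cos b) * sin (b - a)"
    using ls ms by (simp add: sin_diff algebra_simps) algebra
  ultimately have "v = l *\<^sub>R unit_vec (a + pi/2) + m *\<^sub>R unit_vec (b + pi/2)"
    using s by (simp add: vec_eq_iff forall_2 cos_add sin_add)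
  moreover have "l \<ge> 0" "m \<ge> 0" using v s by (simp_all add: l_def m_def divide_nonpos_pos)
  ultimately show ?thesis using that by blast
qed

lemma chord_almost_tangent:
  assumes ab: "a < b" "b - a \<le> d" "d < pi/2" and v: "v \<bullet> unit_vec a \<le> 0" "0 \<le> v \<bullet> unit_vec b"
    and \<tau>: "\<bar>a - \<tau>\<bar> \<le> d" "\<bar>b - \<tau>\<bar> \<le> d"
  shows "norm v * cos d \<le> v \<bullet> unit_vec (\<tau> + pi/2)"
proof -
  obtain l m where lm: "l \<ge> 0" "m \<ge> 0" "v = l *\<^sub>R unit_vec (a + pi/2) + m *\<^sub>R unit_vec (b + pi/2)"
    using chord_in_tangent_cone[of a b v] assms by auto
  have cd: "cos d \<ge> 0" using assms by (intro cos_ge_zero) auto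
  have c: "cos d \<le> cos (t - \<tau>)" if "\<bar>t - \<tau>\<bar> \<le> d" for t
    using cos_monotone_0_pi_le[of "\<bar>t - \<tau>\<bar>" d] that assms by simp
  have "norm v \<le> norm (l *\<^sub>R unit_vec (a + pi/2)) + norm (m *\<^sub>R unit_vec (b + pi/2))"
    unfolding lm(3) by (rule norm_triangle_ineq)
  hence "norm v \<le> l + m" using lm by simp
  hence "norm v * cos d \<le> (l + m) * cos d" using cd by (rule mult_right_mono)
  also have "\<dots> \<le> l * cos (a - \<tau>) + m * cos (b - \<tau>)"
    unfolding distrib_right using lm c[OF \<tau>(1)] c[OF \<tau>(2)] by (intro add_mono mult_left_mono)
  also have "\<dots> = v \<bullet> unit_vec (\<tau> + pi/2)"
    by (simp add: lm(3) inner_add_left inner_unit_vec_unit_vec)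
  finally show ?thesis .
qed

section \<open>Length of arcs parametrised by their normal\<close>

text \<open>A continuous map is a normal parametrisation if \<open>X t\<close> maximises the direction
  \<open>unit_vec t\<close> among all its values, that is, if the image of \<open>X\<close> is supported at
  \<open>X t\<close> by the line with normal \<open>unit_vec t\<close>. The unit circle is treated by the same
  lemmas as the boundary of \<open>K\<close>.\<close>

definition normal_param :: "(real \<Rightarrow> real ^ 2) \<Rightarrow> bool" where
  "normal_param X \<longleftrightarrow> continuous_on UNIV X \<and> (\<forall>s t. X s \<bullet> unit_vec t \<le> X t \<bullet> unit_vec t)"

lemma normal_param_unit_vec: "normal_param unit_vec"
  by (simp add: normal_param_def continuous_on_unit_vec inner_unit_vec_unit_vec)

lemma normal_param_chord:
  assumes X: "normal_param X" and st: "s \<le> t" "t - s \<le> d" "d < pi/2" and \<tau>: "\<bar>s - \<tau>\<bar> \<le> d" "\<bar>t - \<tau>\<bar> \<le> d"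
  shows "norm (X t - X s) * cos d \<le> (X t - X s) \<bullet> unit_vec (\<tau> + pi/2)"
proof (cases "s = t")
  case False
  thus ?thesis using assms
    by (intro chord_almost_tangent[of s t]) (auto simp: normal_param_def inner_diff_left)
qed auto

lemma compact_arc: "normal_param X \<Longrightarrow> compact (X ` {a..b})"
  by (rule compact_continuous_image) (auto simp: normal_param_def intro: continuous_on_subset)

lemma connected_arc: "normal_param X \<Longrightarrow> connected (X ` {a..b})"
  by (rule connected_continuous_image) (auto simp: normal_param_def intro: continuous_on_subset)

lemma borel_compact: "compact (S :: 'a::metric_space set) \<Longrightarrow> S \<in> sets borel"
  by (rule borel_closed) (rule compact_imp_closed)

lemma arc_length_lower:
  assumes X: "normal_param X" and ab: "a \<le> b"
  shows "ennreal (norm (X b - X a)) \<le> emeasure hausdorff1 (X ` {a..b})"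
  using dist_le_hausdorff1_outer_connected[OF connected_arc[OF X], of "X b" a b "X a"] ab
  by (simp add: emeasure_hausdorff1 borel_compact compact_arc[OF X] dist_norm)

text \<open>Projection onto the tangent at \<open>\<tau>\<close> shortens every chord of the arc at most by the
  factor \<open>cos (b - a)\<close>, so the arc is a Lipschitz graph over its projection.\<close>

lemma arc_length_upper:
  assumes X: "normal_param X" and ab: "a \<le> b" "b - a < pi/2" and \<tau>: "a \<le> \<tau>" "\<tau> \<le> b"
  shows "emeasure hausdorff1 (X ` {a..b}) \<le> ennreal (((X b - X a) \<bullet> unit_vec (\<tau> + pi/2)) / cos (b - a))"
proof -
  define p where "p x = x \<bullet> unit_vec (\<tau> + pi/2)" for x
  have cd: "cos (b - a) > 0" using ab by (intro cos_gt_zero_pi) auto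
  have chord: "norm (X t - X s) * cos (b - a) \<le> p (X t) - p (X s)" if "a \<le> s" "s \<le> t" "t \<le> b" for s t
    using normal_param_chord[OF X, of s t "b - a" \<tau>] that ab \<tau> by (auto simp: p_def inner_diff_left)
  have mono: "p (X s) \<le> p (X t)" if "a \<le> s" "s \<le> t" "t \<le> b" for s t
    using chord[OF that] cd by (smt (verit) norm_ge_zero mult_nonneg_nonneg)
  have "hausdorff1_outer (X ` {a..b}) \<le> ennreal (1 / cos (b - a) * (p (X b) - p (X a)))"
  proof (rule hausdorff1_outer_projection_le)
    have le: "dist (X s) (X t) \<le> 1 / cos (b - a) * \<bar>p (X s) - p (X t)\<bar>" if "a \<le> s" "s \<le> t" "t \<le> b" for s t
      using chord[OF that] mono[OF that] cd by (simp add: dist_norm norm_minus_commute field_simps)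
    fix x y assume "x \<in> X ` {a..b}" "y \<in> X ` {a..b}"
    then obtain s t where st: "x = X s" "y = X t" "s \<in> {a..b}" "t \<in> {a..b}" by blast
    show "dist x y \<le> 1 / cos (b - a) * \<bar>p x - p y\<bar>"
      using le[of s t] le[of t s] st by (cases "s \<le> t") (auto simp: dist_commute abs_minus_commute)
  qed (use cd mono ab in auto)
  thus ?thesis by (simp add: emeasure_hausdorff1 borel_compact compact_arc[OF X] p_def inner_diff_left)
qed

lemma arc_length_finite:
  assumes "normal_param X" "a \<le> b" "b - a < pi/2"
  shows "emeasure hausdorff1 (X ` {a..b}) < \<infinity>"
  by (rule le_less_trans[OF arc_length_upper[OF assms order_refl assms(2)]]) simp

lemma measure_arc_bounds:
  assumes X: "normal_param X" and ab: "a \<le> b" "b - a < pi/2" and \<tau>: "a \<le> \<tau>" "\<tau> \<le> b"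
  shows "norm (X b - X a) \<le> measure hausdorff1 (X ` {a..b})"
    and "measure hausdorff1 (X ` {a..b}) * cos (b - a) \<le> (X b - X a) \<bullet> unit_vec (\<tau> + pi/2)"
proof -
  have cd: "cos (b - a) > 0" using ab by (intro cos_gt_zero_pi) auto
  have fin: "emeasure hausdorff1 (X ` {a..b}) = ennreal (measure hausdorff1 (X ` {a..b}))"
    using arc_length_finite[OF X ab] by (intro emeasure_eq_ennreal_measure) auto
  show "norm (X b - X a) \<le> measure hausdorff1 (X ` {a..b})"
    using arc_length_lower[OF X ab(1)] by (simp add: fin)
  have "0 \<le> norm (X b - X a) * cos (b - a)" using cd by simp
  also have "\<dots> \<le> (X b - X a) \<bullet> unit_vec (\<tau> + pi/2)"
    using normal_param_chord[OF X ab(1) order_refl ab(2)] \<tau> ab by auto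
  finally have "0 \<le> (X b - X a) \<bullet> unit_vec (\<tau> + pi/2)" .
  thus "measure hausdorff1 (X ` {a..b}) * cos (b - a) \<le> (X b - X a) \<bullet> unit_vec (\<tau> + pi/2)"
    using arc_length_upper[OF X ab \<tau>] cd unfolding fin by (simp add: field_simps)
qed

section \<open>Differentiability of the normal parametrisation\<close>

text \<open>The mean of \<open>g\<close> over \<open>A\<close> lies between the minimum and the maximum of
  \<open>g\<close>, and \<open>g\<close> attains every value in between because \<open>A\<close> is
  connected.\<close>

lemma nn_integral_mean_value:
  fixes g :: "'a::metric_space \<Rightarrow> real"
  assumes A: "compact A" "connected A" "A \<noteq> {}" and fin: "emeasure hausdorff1 A < \<infinity>"
    and g: "continuous_on A g" "\<And>x. g x \<ge> 0"
  shows "\<exists>x\<in>A. (\<integral>\<^sup>+ y \<in> A. ennreal (g y) \<partial>hausdorff1) = ennreal (g x * measure hausdorff1 A)"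
proof -
  define l where "l = measure hausdorff1 A"
  have l: "emeasure hausdorff1 A = ennreal l" "l \<ge> 0"
    using fin by (auto simp: l_def intro!: emeasure_eq_ennreal_measure)
  have meas: "A \<in> sets hausdorff1" using A by (simp add: borel_compact)
  obtain x1 where x1: "x1 \<in> A" "\<And>y. y \<in> A \<Longrightarrow> g x1 \<le> g y"
    using continuous_attains_inf[OF A(1,3) g(1)] by blast
  obtain x2 where x2: "x2 \<in> A" "\<And>y. y \<in> A \<Longrightarrow> g y \<le> g x2"
    using continuous_attains_sup[OF A(1,3) g(1)] by blast
  let ?I = "\<integral>\<^sup>+ y \<in> A. ennreal (g y) \<partial>hausdorff1"
  have const: "(\<integral>\<^sup>+ y. ennreal c * indicator A y \<partial>hausdorff1) = ennreal (c * l)" if "c \<ge> 0" for c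
    using that l meas by (simp add: nn_integral_cmult_indicator ennreal_mult)
  have lower: "ennreal (g x1 * l) \<le> ?I"
    unfolding const[OF g(2), symmetric] by (intro nn_integral_mono) (auto simp: indicator_def intro!: ennreal_leI x1)
  have upper: "?I \<le> ennreal (g x2 * l)"
    unfolding const[OF g(2), symmetric] by (intro nn_integral_mono) (auto simp: indicator_def intro!: ennreal_leI x2)
  define I where "I = enn2real ?I"
  have I: "?I = ennreal I" using le_less_trans[OF upper ennreal_less_top] by (simp add: I_def)
  have bounds: "g x1 * l \<le> I" "I \<le> g x2 * l"
    using lower upper g(2) l(2) unfolding I by (auto simp: I_def)
  show ?thesis
  proof (cases "l = 0")
    case True
    thus ?thesis using bounds x1(1) unfolding I l_def[symmetric] by auto
  next
    case False
    have "connected (g ` A)" using A g by (intro connected_continuous_image)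
    moreover have "g x1 \<le> I / l" "I / l \<le> g x2" using bounds False l(2) by (auto simp: field_simps)
    ultimately have "I / l \<in> g ` A" using connectedD_interval x1(1) x2(1) by blast
    then obtain x where "x \<in> A" "I / l = g x" by blast
    thus ?thesis using False unfolding I l_def[symmetric] by (intro bexI[of _ x]) (auto simp: field_simps)
  qed
qed

text \<open>Here \<open>q\<close> is the length of an arc of the circle divided by its angle \<open>N\<close>,
  and \<open>c * q / g (X \<eta>)\<close> is the length of the corresponding arc of \<open>X\<close> divided by
  \<open>N\<close>, by the mean value theorem for the mass. Both are squeezed by the chord estimates, which
  leaves bounds on the norm and the tangential component of the difference quotient \<open>v\<close>.\<close>

lemma normal_param_difference_quotient:
  fixes g :: "real ^ 2 \<Rightarrow> real"
  assumes X: "normal_param X" and g: "continuous_on UNIV g" "\<And>x. g x > 0" and c: "c > 0"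
    and eq: "\<And>a b. a < b \<Longrightarrow> b - a < pi/2 \<Longrightarrow> (\<integral>\<^sup>+ y \<in> X ` {a..b}. ennreal (g y) \<partial>hausdorff1)
              = ennreal c * emeasure hausdorff1 (unit_vec ` {a..b})"
    and s: "s \<noteq> \<tau>" "\<bar>s - \<tau>\<bar> < pi/2"
  defines "N \<equiv> \<bar>s - \<tau>\<bar>" and "v \<equiv> (X s - X \<tau>) /\<^sub>R (s - \<tau>)"
  shows "\<exists>\<eta> q. \<bar>\<eta> - \<tau>\<bar> \<le> N \<and> sin N / N \<le> q \<and> q \<le> sin N / N / cos N \<and>
     c * q / g (X \<eta>) * cos N \<le> v \<bullet> unit_vec (\<tau> + pi/2) \<and> v \<bullet> unit_vec (\<tau> + pi/2) \<le> norm v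
     \<and> norm v \<le> c * q / g (X \<eta>)"
proof -
  define a where "a = min s \<tau>"
  define b where "b = max s \<tau>"
  have ab: "a < b" "a \<le> b" "b - a < pi/2" "a \<le> \<tau>" "\<tau> \<le> b" "b - a = N"
    using s by (auto simp: a_def b_def N_def min_def max_def)
  have N: "N > 0" "cos N > 0" using ab by (auto intro!: cos_gt_zero)
  define l where "l = measure hausdorff1 (X ` {a..b})"
  define k where "k = measure hausdorff1 (unit_vec ` {a..b})"
  note fin = arc_length_finite[OF _ ab(2,3)]
  have k: "emeasure hausdorff1 (unit_vec ` {a..b}) = ennreal k"
    using fin[OF normal_param_unit_vec] by (auto simp: k_def intro!: emeasure_eq_ennreal_measure)
  have "\<exists>x\<in>X ` {a..b}. (\<integral>\<^sup>+ y \<in> X ` {a..b}. ennreal (g y) \<partial>hausdorff1) = ennreal (g x * l)"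
    unfolding l_def
    by (rule nn_integral_mean_value)
       (use X ab g fin in \<open>auto simp: compact_arc connected_arc intro: continuous_on_subset less_imp_le\<close>)
  then obtain \<eta> where \<eta>: "\<eta> \<in> {a..b}" "ennreal (g (X \<eta>) * l) = ennreal (c * k)"
    using eq[OF ab(1,3)] c by (auto simp: k ennreal_mult k_def)
  have gl: "g (X \<eta>) * l = c * k"
    using \<eta>(2) c g(2) by (subst (asm) ennreal_inj) (auto simp: l_def k_def less_imp_le)
  hence l: "l = c * k / g (X \<eta>)" using g(2)[of "X \<eta>"] by (simp add: field_simps)
  have k1: "sin N \<le> k"
  proof -
    have "sin N = (unit_vec b - unit_vec a) \<bullet> unit_vec (a + pi/2)"
      by (simp add: inner_diff_left inner_unit_vec_unit_vec ab(6)[symmetric] cos_diff sin_diff algebra_simps cos_add sin_add)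
    also have "\<dots> \<le> norm (unit_vec b - unit_vec a)"
      using norm_cauchy_schwarz[of "unit_vec b - unit_vec a" "unit_vec (a + pi/2)"] by simp
    also have "\<dots> \<le> k" unfolding k_def by (rule measure_arc_bounds(1)[OF normal_param_unit_vec ab(2-5)])
    finally show ?thesis .
  qed
  have k2: "k * cos N \<le> sin N"
  proof -
    have "k * cos N \<le> (unit_vec b - unit_vec a) \<bullet> unit_vec (a + pi/2)"
      unfolding k_def ab(6)[symmetric]
      by (rule measure_arc_bounds(2)[OF normal_param_unit_vec ab(2,3) order_refl ab(2)])
    also have "\<dots> = sin N"
      by (simp add: inner_diff_left inner_unit_vec_unit_vec ab(6)[symmetric] cos_diff sin_diff algebra_simps cos_add sin_add)
    finally show ?thesis .
  qed
  have v: "v = (X b - X a) /\<^sub>R N"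
  proof (cases "s < \<tau>")
    case True
    hence "v = - ((X b - X a) /\<^sub>R (s - \<tau>))" by (simp add: v_def a_def b_def flip: scaleR_minus_right)
    also have "\<dots> = (X b - X a) /\<^sub>R N" using True
      by (simp add: N_def flip: scaleR_minus_left inverse_minus_eq)
    finally show ?thesis .
  qed (auto simp: v_def a_def b_def N_def)
  have "norm (X b - X a) \<le> l" unfolding l_def by (rule measure_arc_bounds(1)[OF X ab(2-5)])
  moreover have "norm v = norm (X b - X a) / N" using N by (simp add: v divide_inverse mult.commute)
  ultimately have "norm v \<le> l / N" using N by (simp add: divide_right_mono)
  moreover have "l * cos N \<le> (X b - X a) \<bullet> unit_vec (\<tau> + pi/2)"
    unfolding l_def ab(6)[symmetric] by (rule measure_arc_bounds(2)[OF X ab(2-5)])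
  hence "l * cos N / N \<le> ((X b - X a) \<bullet> unit_vec (\<tau> + pi/2)) / N" using N by (simp add: divide_right_mono)
  hence "l * cos N / N \<le> v \<bullet> unit_vec (\<tau> + pi/2)"
    by (simp only: v inner_scaleR_left divide_inverse_commute)
  moreover have "v \<bullet> unit_vec (\<tau> + pi/2) \<le> norm v"
    using norm_cauchy_schwarz[of v "unit_vec (\<tau> + pi/2)"] by simp
  moreover have "\<bar>\<eta> - \<tau>\<bar> \<le> N" using \<eta> ab by auto
  moreover have "sin N / N \<le> k / N" "k / N \<le> sin N / N / cos N"
    using k1 k2 N by (auto simp: field_simps)
  moreover have "l / N = c * (k / N) / g (X \<eta>)" "l * cos N / N = c * (k / N) / g (X \<eta>) * cos N"
    by (simp_all add: l)
  ultimately show ?thesis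
    by - (rule exI[of _ \<eta>], rule exI[of _ "k / N"], intro conjI; (assumption | simp only:))
qed

text \<open>In the limit both the norm and the tangential component of the difference quotient tend to \<open>c
  / g (X \<tau>)\<close>. A vector whose component along a unit vector equals its norm is a multiple of that
  vector; quantitatively, \<open>|v - \<rho> w|^2 = |v|^2 - 2 \<rho> (v \<bullet> w) + \<rho>^2\<close> tends to
  \<open>0\<close>.\<close>

lemma normal_param_has_vector_derivative:
  fixes g :: "real ^ 2 \<Rightarrow> real"
  assumes X: "normal_param X" and g: "continuous_on UNIV g" "\<And>x. g x > 0" and c: "c > 0"
    and eq: "\<And>a b. a < b \<Longrightarrow> b - a < pi/2 \<Longrightarrow> (\<integral>\<^sup>+ y \<in> X ` {a..b}. ennreal (g y) \<partial>hausdorff1)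
              = ennreal c * emeasure hausdorff1 (unit_vec ` {a..b})"
  shows "(X has_vector_derivative (c / g (X \<tau>)) *\<^sub>R unit_vec (\<tau> + pi/2)) (at \<tau>)"
proof -
  define \<rho> where "\<rho> = c / g (X \<tau>)"
  define w where "w = unit_vec (\<tau> + pi/2)"
  define v where "v s = (X s - X \<tau>) /\<^sub>R (s - \<tau>)" for s
  define N where "N s = \<bar>s - \<tau>\<bar>" for s
  define G where "G s = (s \<noteq> \<tau> \<and> \<bar>s - \<tau>\<bar> < pi/2)" for s
  have "\<exists>\<eta> q. \<forall>s. G s \<longrightarrow> \<bar>\<eta> s - \<tau>\<bar> \<le> N s \<and> sin (N s) / N s \<le> q s \<and> q s \<le> sin (N s) / N s / cos (N s) \<and>
     c * q s / g (X (\<eta> s)) * cos (N s) \<le> v s \<bullet> w \<and> v s \<bullet> w \<le> norm (v s)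
     \<and> norm (v s) \<le> c * q s / g (X (\<eta> s))"
    using normal_param_difference_quotient[OF X g c eq, where \<tau> = \<tau>]
    unfolding N_def v_def w_def G_def by metis
  then obtain \<eta> q where
    \<eta>: "\<And>s. G s \<Longrightarrow> \<bar>\<eta> s - \<tau>\<bar> \<le> N s" and
    q: "\<And>s. G s \<Longrightarrow> sin (N s) / N s \<le> q s" "\<And>s. G s \<Longrightarrow> q s \<le> sin (N s) / N s / cos (N s)" and
    p: "\<And>s. G s \<Longrightarrow> c * q s / g (X (\<eta> s)) * cos (N s) \<le> v s \<bullet> w" "\<And>s. G s \<Longrightarrow> v s \<bullet> w \<le> norm (v s)"
      "\<And>s. G s \<Longrightarrow> norm (v s) \<le> c * q s / g (X (\<eta> s))"
    by blast
  have ev: "eventually G (at \<tau>)"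
  proof -
    have "eventually (\<lambda>s. s \<noteq> \<tau> \<and> dist s \<tau> < pi/2) (at \<tau>)"
      unfolding eventually_at by (intro exI[of _ "pi/2"]) auto
    thus ?thesis by (rule eventually_mono) (simp add: G_def dist_real_def)
  qed
  have N0: "(N \<longlongrightarrow> 0) (at \<tau>)"
  proof -
    have "((\<lambda>s. \<bar>s - \<tau>\<bar>) \<longlongrightarrow> \<bar>\<tau> - \<tau>\<bar>) (at \<tau>)" by (intro tendsto_intros)
    thus ?thesis by (simp add: N_def[abs_def])
  qed
  have N0': "filterlim N (at 0) (at \<tau>)"
    using N0 by (simp add: filterlim_at eventually_at_filter N_def)
  have cos1: "((\<lambda>s. cos (N s)) \<longlongrightarrow> 1) (at \<tau>)"
    using tendsto_cos[OF N0] by simp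
  have "((\<lambda>x::real. sin x / x) \<longlongrightarrow> 1) (at 0)"
    using DERIV_sin[of "0::real"] by (simp add: has_field_derivative_iff)
  from filterlim_compose[OF this N0'] have sin1: "((\<lambda>s. sin (N s) / N s) \<longlongrightarrow> 1) (at \<tau>)" .
  have "((\<lambda>s. sin (N s) / N s / cos (N s)) \<longlongrightarrow> 1 / 1) (at \<tau>)"
    by (intro tendsto_divide sin1 cos1) simp
  hence sincos1: "((\<lambda>s. sin (N s) / N s / cos (N s)) \<longlongrightarrow> 1) (at \<tau>)"
    by (simp only: div_by_1)
  have q1: "(q \<longlongrightarrow> 1) (at \<tau>)"
    by (rule real_tendsto_sandwich[OF _ _ sin1 sincos1]; rule eventually_mono[OF ev], erule q)
  have "((\<lambda>s. \<eta> s - \<tau>) \<longlongrightarrow> 0) (at \<tau>)"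
    by (rule Lim_null_comparison[OF _ N0]) (auto intro: eventually_mono[OF ev] \<eta>)
  hence "(\<eta> \<longlongrightarrow> \<tau>) (at \<tau>)" by (simp add: LIM_zero_iff)
  moreover have "isCont (\<lambda>t. g (X t)) \<tau>"
    using X g(1) by (auto simp: normal_param_def continuous_on_eq_continuous_at intro: continuous_at_compose[unfolded o_def])
  ultimately have "((\<lambda>s. g (X (\<eta> s))) \<longlongrightarrow> g (X \<tau>)) (at \<tau>)" by (rule isCont_tendsto_compose[rotated])
  hence "((\<lambda>s. c * q s / g (X (\<eta> s))) \<longlongrightarrow> c * 1 / g (X \<tau>)) (at \<tau>)"
    using g(2) by (intro tendsto_intros q1) (auto simp: less_imp_neq[symmetric])
  hence up: "((\<lambda>s. c * q s / g (X (\<eta> s))) \<longlongrightarrow> \<rho>) (at \<tau>)" by (simp add: \<rho>_def)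
  from tendsto_mult[OF this cos1]
  have low: "((\<lambda>s. c * q s / g (X (\<eta> s)) * cos (N s)) \<longlongrightarrow> \<rho>) (at \<tau>)" by simp
  have pl: "((\<lambda>s. v s \<bullet> w) \<longlongrightarrow> \<rho>) (at \<tau>)"
    by (rule real_tendsto_sandwich[OF _ _ low up]; rule eventually_mono[OF ev], use p order_trans[OF p(2) p(3)] in blast)
  have nl: "((\<lambda>s. norm (v s)) \<longlongrightarrow> \<rho>) (at \<tau>)"
    by (rule real_tendsto_sandwich[OF _ _ low up]; rule eventually_mono[OF ev], use p order_trans[OF p(1) p(2)] in blast)
  have "((\<lambda>s. sqrt ((norm (v s))\<^sup>2 - 2 * \<rho> * (v s \<bullet> w) + \<rho>\<^sup>2)) \<longlongrightarrow> sqrt (\<rho>\<^sup>2 - 2 * \<rho> * \<rho> + \<rho>\<^sup>2)) (at \<tau>)"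
    by (intro tendsto_intros pl nl)
  also have "\<rho>\<^sup>2 - 2 * \<rho> * \<rho> + \<rho>\<^sup>2 = 0" by (simp add: power2_eq_square)
  also have "(\<lambda>s. sqrt ((norm (v s))\<^sup>2 - 2 * \<rho> * (v s \<bullet> w) + \<rho>\<^sup>2)) = (\<lambda>s. norm (v s - \<rho> *\<^sub>R w))"
  proof
    fix s
    have "w \<bullet> w = 1" by (simp add: w_def inner_unit_vec_unit_vec)
    hence "(norm (v s - \<rho> *\<^sub>R w))\<^sup>2 = (norm (v s))\<^sup>2 - 2 * \<rho> * (v s \<bullet> w) + \<rho>\<^sup>2"
      unfolding power2_norm_eq_inner
      by (simp add: inner_diff_left inner_diff_right inner_commute power2_eq_square algebra_simps)
    thus "sqrt ((norm (v s))\<^sup>2 - 2 * \<rho> * (v s \<bullet> w) + \<rho>\<^sup>2) = norm (v s - \<rho> *\<^sub>R w)"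
      by (metis norm_ge_zero real_sqrt_unique)
  qed
  finally have lim: "((\<lambda>s. norm (v s - \<rho> *\<^sub>R w)) \<longlongrightarrow> 0) (at \<tau>)" by simp
  have "((\<lambda>s. norm ((X s - X \<tau>) - (s - \<tau>) *\<^sub>R (\<rho> *\<^sub>R w)) / norm (s - \<tau>)) \<longlongrightarrow> 0) (at \<tau>)"
  proof (rule Lim_transform_eventually[OF lim])
    show "\<forall>\<^sub>F s in at \<tau>. norm (v s - \<rho> *\<^sub>R w) = norm ((X s - X \<tau>) - (s - \<tau>) *\<^sub>R (\<rho> *\<^sub>R w)) / norm (s - \<tau>)"
    proof (rule eventually_mono[OF ev])
      fix s assume "G s"
      hence "X s - X \<tau> - (s - \<tau>) *\<^sub>R (\<rho> *\<^sub>R w) = (s - \<tau>) *\<^sub>R (v s - \<rho> *\<^sub>R w)"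
        by (simp add: v_def G_def scaleR_diff_right)
      thus "norm (v s - \<rho> *\<^sub>R w) = norm ((X s - X \<tau>) - (s - \<tau>) *\<^sub>R (\<rho> *\<^sub>R w)) / norm (s - \<tau>)"
        using \<open>G s\<close> by (simp add: G_def)
    qed
  qed
  thus ?thesis unfolding has_vector_derivative_def has_derivative_iff_norm \<rho>_def[symmetric] w_def[symmetric]
    by (intro conjI bounded_linear_scaleR_left)
qed

section \<open>From the measure to the support function\<close>

definition normal_face :: "(real ^ 2) set \<Rightarrow> real \<Rightarrow> (real ^ 2) set" where
  "normal_face K t = {x \<in> K. \<forall>y\<in>K. y \<bullet> unit_vec t \<le> x \<bullet> unit_vec t}"

lemma normal_face_eq:
  "normal_face K t = K \<inter> (\<Inter>y\<in>K. {x. unit_vec t \<bullet> x \<ge> unit_vec t \<bullet> y})"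
  by (auto simp: normal_face_def inner_commute)

lemma compact_normal_face: "compact K \<Longrightarrow> compact (normal_face K t)"
  unfolding normal_face_eq by (intro compact_Int_closed closed_INT ballI closed_halfspace_ge)

lemma convex_normal_face: "convex K \<Longrightarrow> convex (normal_face K t)"
  unfolding normal_face_eq by (intro convex_Int convex_INT convex_halfspace_ge)

lemma normal_face_nonempty:
  assumes "compact K" "K \<noteq> {}" shows "normal_face K t \<noteq> {}"
proof -
  have "continuous_on K (\<lambda>x. x \<bullet> unit_vec t)" by (intro continuous_intros)
  from continuous_attains_sup[OF assms this] show ?thesis by (auto simp: normal_face_def)
qed

lemma support_function_normal_face:
  "x \<in> normal_face K t \<Longrightarrow> support_function K (unit_vec t) = x \<bullet> unit_vec t"
  unfolding support_function_def by (intro cSup_eq_maximum) (auto simp: normal_face_def)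

lemma inv_gauss_map_unit_vec:
  assumes "closed K"
  shows "inv_gauss_map K (unit_vec ` T) = (\<Union>t\<in>T. normal_face K t)"
proof (intro equalityI subsetI)
  fix x assume "x \<in> inv_gauss_map K (unit_vec ` T)"
  thus "x \<in> (\<Union>t\<in>T. normal_face K t)"
    using frontier_subset_closed[OF assms]
    by (auto simp: inv_gauss_map_def outer_unit_normal_def normal_face_def)
next
  fix x assume "x \<in> (\<Union>t\<in>T. normal_face K t)"
  then obtain t where t: "t \<in> T" "x \<in> K" "\<And>y. y \<in> K \<Longrightarrow> y \<bullet> unit_vec t \<le> x \<bullet> unit_vec t"
    by (auto simp: normal_face_def)
  have "x \<notin> interior K"
  proof
    assume "x \<in> interior K"
    then obtain e where e: "e > 0" "cball x e \<subseteq> K" by (auto simp: mem_interior_cball)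
    hence "x + e *\<^sub>R unit_vec t \<in> K" by (auto simp: dist_norm)
    from t(3)[OF this] e show False by (simp add: inner_add_left inner_unit_vec_unit_vec)
  qed
  hence "x \<in> frontier K" using t(2) closure_subset by (auto simp: frontier_def)
  thus "x \<in> inv_gauss_map K (unit_vec ` T)"
    using t by (auto simp: inv_gauss_map_def outer_unit_normal_def)
qed

lemma continuous_on_gauss: "continuous_on S (\<lambda>x::'a::real_normed_vector. exp (- (norm x)\<^sup>2 / 2))"
  by (intro continuous_intros) auto

lemma gaussian_surface_area_eq_unit_vec:
  assumes K: "compact K" and eq: "gaussian_surface_area_eq K C" and C: "C > 0"
  shows "(\<integral>\<^sup>+ x \<in> (\<Union>t\<in>{a..b}. normal_face K t). ennreal (exp (- (norm x)\<^sup>2 / 2)) \<partial>hausdorff1)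
     = ennreal (2 * pi * C) * emeasure hausdorff1 (unit_vec ` {a..b})" (is "?I = _")
proof -
  have "unit_vec ` {a..b} \<in> sets borel"
    by (intro borel_compact compact_continuous_image continuous_on_unit_vec compact_Icc)
  hence "gaussian_surface_area K (unit_vec ` {a..b}) = ennreal C * emeasure hausdorff1 (unit_vec ` {a..b})"
    using eq by (auto simp: gaussian_surface_area_eq_def)
  hence "ennreal (1 / (2 * pi)) * ?I = ennreal C * emeasure hausdorff1 (unit_vec ` {a..b})"
    by (simp add: gaussian_surface_area_def inv_gauss_map_unit_vec compact_imp_closed[OF K])
  hence "ennreal (2 * pi) * (ennreal (1 / (2 * pi)) * ?I)
      = ennreal (2 * pi) * (ennreal C * emeasure hausdorff1 (unit_vec ` {a..b}))" by simp
  thus ?thesis using C by (simp add: mult.assoc[symmetric] ennreal_mult'[symmetric])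
qed

text \<open>A face with more than one point would be a segment of positive length, carrying positive Gaussian
  mass over a single normal.\<close>

lemma normal_face_singleton:
  assumes K: "convex_body K" and eq: "gaussian_surface_area_eq K C" and C: "C > 0"
  shows "\<exists>x. normal_face K t = {x}"
proof -
  have cK: "compact K" "convex K" "K \<noteq> {}" using K by (auto simp: convex_body_def)
  let ?F = "normal_face K t"
  let ?g = "\<lambda>x :: real ^ 2. exp (- (norm x)\<^sup>2 / 2)"
  have F: "compact ?F" "convex ?F" "?F \<noteq> {}"
    using cK compact_normal_face convex_normal_face normal_face_nonempty by blast+
  have "(\<integral>\<^sup>+ x \<in> ?F. ennreal (?g x) \<partial>hausdorff1) = 0"
    using gaussian_surface_area_eq_unit_vec[OF cK(1) eq C, of t t] by (simp add: emeasure_hausdorff1)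
  moreover obtain m where m: "m > 0" "\<And>x. x \<in> ?F \<Longrightarrow> m \<le> ?g x"
    using continuous_attains_inf[OF F(1,3) continuous_on_gauss] exp_gt_zero by metis
  have "(\<integral>\<^sup>+ x. ennreal m * indicator ?F x \<partial>hausdorff1) \<le> (\<integral>\<^sup>+ x \<in> ?F. ennreal (?g x) \<partial>hausdorff1)"
    by (intro nn_integral_mono) (use m(2) in \<open>auto simp: indicator_def intro!: ennreal_leI\<close>)
  ultimately have "ennreal m * emeasure hausdorff1 ?F = 0"
    using F(1) by (simp add: nn_integral_cmult_indicator borel_compact)
  hence "emeasure hausdorff1 ?F = 0" using m(1) by simp
  hence F0: "hausdorff1_outer ?F = 0" using F(1) by (simp add: emeasure_hausdorff1 borel_compact)
  have "x = y" if "x \<in> ?F" "y \<in> ?F" for x y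
    using dist_le_hausdorff1_outer_connected[OF convex_connected[OF F(2)] that] F0 by simp
  thus ?thesis using F(3) by blast
qed

text \<open>The graph of \<open>X\<close> is closed because it is cut out by the support inequalities; since
  \<open>K\<close> is compact, \<open>X\<close> is continuous.\<close>

lemma normal_param_exists:
  assumes K: "convex_body K" and eq: "gaussian_surface_area_eq K C" and C: "C > 0"
  obtains X where "normal_param X" "\<And>t. normal_face K t = {X t}"
proof -
  have cK: "compact K" using K by (auto simp: convex_body_def)
  obtain X where X: "\<And>t. normal_face K t = {X t}" using normal_face_singleton[OF assms] by metis
  have XK: "X t \<in> K" and X_max: "\<And>y. y \<in> K \<Longrightarrow> y \<bullet> unit_vec t \<le> X t \<bullet> unit_vec t" for t
    using X[of t] by (auto simp: normal_face_def)
  have graph: "(\<lambda>t. (t, X t)) ` UNIV = snd -` K \<inter> (\<Inter>y\<in>K. {p. y \<bullet> unit_vec (fst p) \<le> snd p \<bullet> unit_vec (fst p)})"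
  proof (intro equalityI subsetI)
    fix p assume "p \<in> snd -` K \<inter> (\<Inter>y\<in>K. {p. y \<bullet> unit_vec (fst p) \<le> snd p \<bullet> unit_vec (fst p)})"
    hence "snd p \<in> normal_face K (fst p)" by (auto simp: normal_face_def)
    hence "snd p = X (fst p)" using X by auto
    thus "p \<in> (\<lambda>t. (t, X t)) ` UNIV" by (intro image_eqI[of _ _ "fst p"]) (auto simp: prod_eq_iff)
  qed (use XK X_max in auto)
  have u: "continuous_on UNIV (\<lambda>p :: real \<times> (real ^ 2). unit_vec (fst p))"
    by (intro continuous_on_compose2[OF continuous_on_unit_vec[of UNIV]] continuous_intros) auto
  have "continuous_on UNIV X"
  proof (rule continuous_from_closed_graph[OF cK])
    show "closed ((\<lambda>t. (t, X t)) ` UNIV)" unfolding graph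
      by (intro closed_Int closed_INT ballI closed_vimage compact_imp_closed[OF cK] closed_Collect_le continuous_intros u)
  qed (use XK in auto)
  hence "normal_param X" using XK X_max by (auto simp: normal_param_def)
  thus ?thesis using X that by blast
qed

text \<open>With \<open>X' = \<rho> unit_vec (t + pi/2)\<close>, the product rule gives \<open>h'\<close> as the
  tangential component of \<open>X\<close> and \<open>h'' = \<rho> - h\<close>, while \<open>|X|^2 = h^2 +
  h'^2\<close>.\<close>

lemma gaussian_surface_area_eq_imp_nonneg_solution:
  assumes K: "convex_body K" and K0: "0 \<in> K" and C: "C > 0" and eq: "gaussian_surface_area_eq K C"
  shows "nonneg_solution C (\<lambda>t. support_function K (unit_vec t))"
proof -
  have cK: "compact K" using K by (auto simp: convex_body_def)
  obtain X where X: "normal_param X" and face: "\<And>t. normal_face K t = {X t}"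
    using normal_param_exists[OF K eq C] by metis
  let ?g = "\<lambda>x :: real ^ 2. exp (- (norm x)\<^sup>2 / 2)"
  define \<rho> where "\<rho> t = 2 * pi * C / ?g (X t)" for t
  have X': "(X has_vector_derivative \<rho> t *\<^sub>R unit_vec (t + pi/2)) (at t)" for t
    unfolding \<rho>_def
  proof (rule normal_param_has_vector_derivative[OF X])
    fix a b :: real
    have "(\<Union>t\<in>{a..b}. normal_face K t) = X ` {a..b}" by (auto simp: face)
    thus "(\<integral>\<^sup>+ x \<in> X ` {a..b}. ennreal (?g x) \<partial>hausdorff1)
        = ennreal (2 * pi * C) * emeasure hausdorff1 (unit_vec ` {a..b})"
      using gaussian_surface_area_eq_unit_vec[OF cK eq C, of a b] by simp
  qed (use C continuous_on_gauss in auto)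
  define h where "h t = X t \<bullet> unit_vec t" for t
  define h1 where "h1 t = X t \<bullet> unit_vec (t + pi/2)" for t
  have sf: "(\<lambda>t. support_function K (unit_vec t)) = h"
    using face support_function_normal_face by (auto simp: h_def fun_eq_iff)
  note inner_deriv = bounded_bilinear.has_vector_derivative[OF bounded_bilinear_inner]
  have h: "(h has_real_derivative h1 t) (at t)" for t
    using inner_deriv[OF X' has_vector_derivative_unit_vec, of t]
    by (simp add: h_def[abs_def] h1_def has_real_derivative_iff_has_vector_derivative inner_unit_vec_unit_vec)
  have "((\<lambda>t. unit_vec (t + pi/2)) has_vector_derivative - unit_vec t) (at t)" for t
  proof -
    have "((\<lambda>t. t + pi/2) has_vector_derivative 1) (at t)" by (auto intro!: derivative_eq_intros)
    from vector_diff_chain_at[OF this has_vector_derivative_unit_vec] show ?thesis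
      by (simp add: o_def unit_vec_pi[symmetric] add.assoc)
  qed
  from inner_deriv[OF X' this]
  have h1: "(h1 has_real_derivative \<rho> t - h t) (at t)" for t
    by (simp add: h_def h1_def[abs_def] has_real_derivative_iff_has_vector_derivative inner_unit_vec_unit_vec)
  have dh: "deriv h = h1" "deriv h1 t = \<rho> t - h t" for t
    using h h1 by (auto simp: fun_eq_iff intro!: DERIV_imp_deriv)
  show ?thesis unfolding sf nonneg_solution_def dh
  proof (intro conjI allI)
    fix t
    show "h (t + 2 * pi) = h t" by (simp add: sf[symmetric])
    have "X t \<in> normal_face K t" using face by simp
    hence "0 \<bullet> unit_vec t \<le> X t \<bullet> unit_vec t" using K0 unfolding normal_face_def by blast
    thus "h t \<ge> 0" by (simp add: h_def)
    show "h differentiable at t" "h1 differentiable at t"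
      using h h1 real_differentiable_def by blast+
    have "(h1 t)\<^sup>2 + (h t)\<^sup>2 = (norm (X t))\<^sup>2" using norm_sq_polar[of "X t" t] by (simp add: h_def h1_def)
    thus "1 / (2 * pi) * exp (- ((h1 t)\<^sup>2 + (h t)\<^sup>2) / 2) * (\<rho> t - h t + h t) = C"
      by (simp add: \<rho>_def)
  qed
qed

section \<open>Disks\<close>

text \<open>A point of \<open>K\<close> at distance more than \<open>r\<close> from the origin would violate the
  bound in its own direction; a point of the ball outside \<open>K\<close> would be separated from
  \<open>K\<close> by a line, in whose normal direction the support function would be less than
  \<open>r\<close>.\<close>

lemma constant_support_function_imp_cball:
  assumes K: "convex_body K" and r: "\<And>t. support_function K (unit_vec t) = r"
  shows "r > 0" and "K = cball 0 r"
proof -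
  have cK: "compact K" "convex K" "K \<noteq> {}" using K by (auto simp: convex_body_def)
  have le: "x \<bullet> unit_vec t \<le> r" if "x \<in> K" for x t
  proof -
    obtain y where "y \<in> normal_face K t" using normal_face_nonempty[OF cK(1,3)] by blast
    thus ?thesis using that r[of t] support_function_normal_face[of y K t] by (auto simp: normal_face_def)
  qed
  have sub: "K \<subseteq> cball 0 r"
  proof
    fix x assume x: "x \<in> K"
    show "x \<in> cball 0 r"
    proof (cases "x = 0")
      case True
      thus ?thesis using le[OF x, of 0] by simp
    next
      case False
      then obtain t where "x /\<^sub>R norm x = unit_vec t" by (metis norm_sgn sgn_div_norm unit_vec_surj)
      hence "x = norm x *\<^sub>R unit_vec t" using False by (metis divideR_right norm_eq_zero)
      hence "x \<bullet> unit_vec t = norm x" by (metis inner_scaleR_left inner_unit_vec_unit_vec cos_zero diff_self mult.right_neutral)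
      thus ?thesis using le[OF x, of t] by simp
    qed
  qed
  show "r > 0"
  proof (rule ccontr)
    assume "\<not> r > 0"
    hence "x \<in> cball 0 r \<Longrightarrow> x = 0" for x :: "real ^ 2"
      by (smt (verit) mem_cball_0 norm_le_zero_iff)
    hence "cball 0 r \<subseteq> {0 :: real ^ 2}" by blast
    hence "interior K \<subseteq> interior {0}" using sub by (intro interior_mono) blast
    thus False using K by (simp add: convex_body_def)
  qed
  have "cball 0 r \<subseteq> K"
  proof (rule subsetI, rule ccontr)
    fix x assume x: "x \<in> cball 0 r" "x \<notin> K"
    then obtain a b where ab: "a \<bullet> x < b" "\<And>y. y \<in> K \<Longrightarrow> a \<bullet> y > b"
      using separating_hyperplane_closed_point[of K x] cK by (auto simp: compact_imp_closed)
    have "a \<noteq> 0" using ab cK(3) by force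
    then obtain t where "(- a) /\<^sub>R norm a = unit_vec t"
      by (metis norm_minus_cancel norm_sgn sgn_div_norm unit_vec_surj neg_equal_0_iff_equal)
    hence a: "a = - norm a *\<^sub>R unit_vec t"
      using \<open>a \<noteq> 0\<close> by (metis divideR_right norm_eq_zero scaleR_minus_left minus_minus)
    obtain y where "y \<in> normal_face K t" using normal_face_nonempty[OF cK(1,3)] by blast
    hence y: "y \<in> K" "y \<bullet> unit_vec t = r"
      using r[of t] support_function_normal_face[of y K t] by (auto simp: normal_face_def)
    have "a \<bullet> x < a \<bullet> y" using ab y by force
    hence "norm a * (y \<bullet> unit_vec t) < norm a * (x \<bullet> unit_vec t)"
      by (subst (asm) (1 2) a) (simp add: inner_commute)
    hence "r < x \<bullet> unit_vec t" using y \<open>a \<noteq> 0\<close> by simp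
    also have "\<dots> \<le> norm x" using norm_cauchy_schwarz[of x "unit_vec t"] by simp
    finally show False using x by simp
  qed
  with sub show "K = cball 0 r" by blast
qed

text \<open>A point \<open>x\<close> of the sphere with normal \<open>u\<close> maximises the inner product with
  \<open>u\<close> over the ball, which forces equality in the Cauchy--Schwarz inequality.\<close>

lemma inv_gauss_map_cball:
  assumes r: "r > 0" and \<eta>: "\<eta> \<subseteq> sphere 0 1"
  shows "inv_gauss_map (cball (0::'a::euclidean_space) r) \<eta> = (\<lambda>u. r *\<^sub>R u) ` \<eta>"
proof (intro equalityI subsetI)
  fix x assume "x \<in> inv_gauss_map (cball 0 r) \<eta>"
  then obtain u where u: "norm x = r" "u \<in> \<eta>" "norm u = 1" "\<And>y. norm y \<le> r \<Longrightarrow> y \<bullet> u \<le> x \<bullet> u"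
    using r by (auto simp: inv_gauss_map_def outer_unit_normal_def)
  have "u \<bullet> u = 1" using u(3) by (simp add: norm_eq_1)
  moreover have "r *\<^sub>R u \<bullet> u \<le> x \<bullet> u" using u r by (intro u(4)) simp
  ultimately have "r \<le> x \<bullet> u" by simp
  moreover have "x \<bullet> x = r * r" using u(1) by (metis power2_norm_eq_inner power2_eq_square)
  hence "(norm (x - r *\<^sub>R u))\<^sup>2 = 2 * r * (r - x \<bullet> u)"
    using \<open>u \<bullet> u = 1\<close> unfolding power2_norm_eq_inner
    by (simp add: inner_diff_left inner_diff_right inner_commute algebra_simps)
  moreover have "2 * r * (r - x \<bullet> u) \<le> 0" using r \<open>r \<le> x \<bullet> u\<close> by (simp add: mult_nonneg_nonpos)
  ultimately have "(norm (x - r *\<^sub>R u))\<^sup>2 \<le> 0" by linarith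
  hence "x = r *\<^sub>R u" by simp
  thus "x \<in> (\<lambda>u. r *\<^sub>R u) ` \<eta>" using u by blast
next
  fix x assume "x \<in> (\<lambda>u. r *\<^sub>R u) ` \<eta>"
  then obtain u where u: "u \<in> \<eta>" "x = r *\<^sub>R u" "norm u = 1" using \<eta> by auto
  have "y \<bullet> u \<le> x \<bullet> u" if "norm y \<le> r" for y
  proof -
    have "y \<bullet> u \<le> norm y" using norm_cauchy_schwarz[of y u] u by simp
    also have "\<dots> \<le> x \<bullet> u" using that u by (simp add: norm_eq_1)
    finally show ?thesis .
  qed
  thus "x \<in> inv_gauss_map (cball 0 r) \<eta>"
    using u r by (auto simp: inv_gauss_map_def outer_unit_normal_def)
qed

text \<open>Scaling and its inverse are both Lipschitz with the reciprocal constants.\<close>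

lemma hausdorff1_outer_scaleR:
  fixes A :: "'a::real_normed_vector set"
  assumes r: "r > 0"
  shows "hausdorff1_outer ((\<lambda>u. r *\<^sub>R u) ` A) = ennreal r * hausdorff1_outer A"
proof (rule antisym)
  show "hausdorff1_outer ((\<lambda>u. r *\<^sub>R u) ` A) \<le> ennreal r * hausdorff1_outer A"
    by (rule hausdorff1_outer_lipschitz_image_le) (use r in \<open>auto simp: dist_norm simp flip: scaleR_diff_right\<close>)
  have "A = (\<lambda>u. (1 / r) *\<^sub>R u) ` (\<lambda>u. r *\<^sub>R u) ` A" using r by (simp add: image_image)
  hence "hausdorff1_outer A \<le> ennreal (1 / r) * hausdorff1_outer ((\<lambda>u. r *\<^sub>R u) ` A)"
    using hausdorff1_outer_lipschitz_image_le[of "1 / r" "\<lambda>u. (1 / r) *\<^sub>R u" "(\<lambda>u. r *\<^sub>R u) ` A"] r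
    by (simp add: dist_norm divide_inverse mult.commute flip: scaleR_diff_right)
  hence "ennreal r * hausdorff1_outer A \<le> ennreal r * (ennreal (1 / r) * hausdorff1_outer ((\<lambda>u. r *\<^sub>R u) ` A))"
    by (rule mult_left_mono) simp
  also have "\<dots> = hausdorff1_outer ((\<lambda>u. r *\<^sub>R u) ` A)"
    using r by (simp add: mult.assoc[symmetric] ennreal_mult'[symmetric])
  finally show "ennreal r * hausdorff1_outer A \<le> hausdorff1_outer ((\<lambda>u. r *\<^sub>R u) ` A)" .
qed

lemma gaussian_surface_area_cball:
  assumes r: "r > 0" and \<eta>: "\<eta> \<in> sets borel" "\<eta> \<subseteq> sphere 0 1"
  shows "gaussian_surface_area (cball 0 r) \<eta> = ennreal (r * exp (- r\<^sup>2 / 2) / (2 * pi)) * emeasure hausdorff1 \<eta>"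
proof -
  let ?A = "(\<lambda>u :: real ^ 2. r *\<^sub>R u) ` \<eta>"
  have "?A = (\<lambda>u. (1 / r) *\<^sub>R u) -` \<eta> \<inter> space borel"
    using r by (force intro: image_eqI[of _ _ "(1 / r) *\<^sub>R x" for x])
  also have "\<dots> \<in> sets borel"
    by (rule measurable_sets[OF _ \<eta>(1)]) (auto intro!: borel_measurable_continuous_onI continuous_intros)
  finally have meas: "?A \<in> sets borel" .
  have "(\<integral>\<^sup>+ x \<in> ?A. ennreal (exp (- (norm x)\<^sup>2 / 2)) \<partial>hausdorff1)
      = (\<integral>\<^sup>+ x. ennreal (exp (- r\<^sup>2 / 2)) * indicator ?A x \<partial>hausdorff1)"
  proof (rule nn_integral_cong)
    fix x :: "real ^ 2"
    have "norm x = r" if "x \<in> ?A" using that \<eta> r by auto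
    thus "ennreal (exp (- (norm x)\<^sup>2 / 2)) * indicator ?A x = ennreal (exp (- r\<^sup>2 / 2)) * indicator ?A x"
      by (auto simp: indicator_def)
  qed
  also have "\<dots> = ennreal (exp (- r\<^sup>2 / 2)) * (ennreal r * emeasure hausdorff1 \<eta>)"
    using meas \<eta> by (simp add: nn_integral_cmult_indicator emeasure_hausdorff1 hausdorff1_outer_scaleR[OF r])
  finally have "gaussian_surface_area (cball 0 r) \<eta>
      = ennreal (1 / (2 * pi)) * (ennreal (exp (- r\<^sup>2 / 2)) * (ennreal r * emeasure hausdorff1 \<eta>))"
    unfolding gaussian_surface_area_def inv_gauss_map_cball[OF r \<eta>(2)] by (rule arg_cong)
  also have "\<dots> = (ennreal (1 / (2 * pi)) * (ennreal (exp (- r\<^sup>2 / 2)) * ennreal r)) * emeasure hausdorff1 \<eta>"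
    by (simp only: mult.assoc)
  also have "ennreal (1 / (2 * pi)) * (ennreal (exp (- r\<^sup>2 / 2)) * ennreal r)
      = ennreal (1 / (2 * pi) * (exp (- r\<^sup>2 / 2) * r))"
    using r by (subst ennreal_mult, simp, simp, subst ennreal_mult) simp_all
  also have "1 / (2 * pi) * (exp (- r\<^sup>2 / 2) * r) = r * exp (- r\<^sup>2 / 2) / (2 * pi)" by simp
  finally show ?thesis .
qed

theorem theorem1p1:
  "(\<forall>(K :: (real ^ 2) set) C :: real. convex_body K \<and> 0 \<in> K \<and> C > 0 \<longrightarrow>
      (gaussian_surface_area_eq K C \<longleftrightarrow>
         nonneg_solution C (\<lambda>\<theta>. support_function K (unit_vec \<theta>))))
   \<and> (\<forall>K :: (real ^ 2) set. convex_body K \<and> 0 \<in> K \<and> (\<exists>C>0. gaussian_surface_area_eq K C) \<longrightarrow>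
        (\<exists>r>0. K = cball 0 r) \<and> support_function K constant_on sphere 0 1)
   \<and> (\<forall>C :: real. 0 < C \<and> C < exp (-1/2) / (2 * pi) \<longrightarrow> card {h. nonneg_solution C h} = 2)
   \<and> (\<forall>C :: real. C = exp (-1/2) / (2 * pi) \<longrightarrow> (\<exists>!h. nonneg_solution C h))
   \<and> (\<forall>C :: real. C > exp (-1/2) / (2 * pi) \<longrightarrow> \<not> (\<exists>h. nonneg_solution C h))"
proof (intro conjI allI impI; (elim conjE exE)?)
  fix K :: "(real ^ 2) set" and C :: real
  assume K: "convex_body K" "0 \<in> K" "C > 0"
  show "gaussian_surface_area_eq K C \<longleftrightarrow> nonneg_solution C (\<lambda>\<theta>. support_function K (unit_vec \<theta>))"
  proof
    assume sol: "nonneg_solution C (\<lambda>\<theta>. support_function K (unit_vec \<theta>))"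
    then obtain r where r: "(\<lambda>\<theta>. support_function K (unit_vec \<theta>)) = (\<lambda>_. r)"
      using nonneg_solution_constant[OF K(3)] by metis
    hence "K = cball 0 r" "r > 0" using constant_support_function_imp_cball[OF K(1), of r] by metis+
    moreover have "r * exp (- r\<^sup>2 / 2) = 2 * pi * C"
      using sol unfolding r nonneg_solution_const_iff by simp
    hence "C = r * exp (- r\<^sup>2 / 2) / (2 * pi)" by simp
    ultimately show "gaussian_surface_area_eq K C"
      by (simp add: gaussian_surface_area_eq_def gaussian_surface_area_cball)
  qed (rule gaussian_surface_area_eq_imp_nonneg_solution[OF K])
next
  fix K :: "(real ^ 2) set" and C :: real
  assume K: "convex_body K" "0 \<in> K" "C > 0" "gaussian_surface_area_eq K C"
  have "nonneg_solution C (\<lambda>\<theta>. support_function K (unit_vec \<theta>))"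
    by (rule gaussian_surface_area_eq_imp_nonneg_solution[OF K])
  then obtain r where r: "(\<lambda>\<theta>. support_function K (unit_vec \<theta>)) = (\<lambda>_. r)"
    using nonneg_solution_constant[OF K(3)] by metis
  hence "K = cball 0 r" "r > 0" using constant_support_function_imp_cball[OF K(1), of r] by metis+
  thus "\<exists>r>0. K = cball 0 r" by blast
  show "support_function K constant_on sphere 0 1"
    unfolding constant_on_def
  proof (intro exI ballI)
    fix u :: "real ^ 2" assume "u \<in> sphere 0 1"
    then obtain t where "u = unit_vec t" using unit_vec_surj by auto
    thus "support_function K u = r" using r by metis
  qed
next
  fix C :: real assume C: "0 < C" "C < exp (-1/2) / (2 * pi)"
  show "card {h. nonneg_solution C h} = 2" by (rule count_nonneg_solutions(1)[OF C])
next
  fix C :: real assume C: "C = exp (-1/2) / (2 * pi)"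
  hence "C > 0" by simp
  thus "\<exists>!h. nonneg_solution C h" by (rule count_nonneg_solutions(2)[OF _ C])
next
  fix C :: real assume C: "C > exp (-1/2) / (2 * pi)"
  moreover have "exp (-1/2) / (2 * pi) > 0" by simp
  ultimately have "C > 0" by (rule less_trans[rotated])
  thus "\<not> (\<exists>h. nonneg_solution C h)" by (rule count_nonneg_solutions(3)[OF _ C])
qed

end
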